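(* Consider a stable matching instance with $M$ men and $W$ women, and let $N=\min(M,W)$. Let $r\ge1$. Assume that each person $p$ has, independently, popularity preferences defined by $\mathcal D_p$ over a set of $d_p\ge1$ acceptable partners. Assume further that whenever man $m$ and woman $w$ are mutually acceptable, $\mathcal D_w(m)$ and $\mathcal D_m(w)$ are within a factor $r$ of each other. Then \[\mathbb E[\text{number of stable pairs}]\le N(1+\ln r)+\sum_{w\in\mathcal W}\frac{\ln d_w}{2}+\sum_{m\in\mathcal M}\frac{\ln d_m}{2}.\] When $r=1$, the expected number of stable pairs is at most $N+N\ln N$.
   Context: Popularity preferences: a person $p$ assigns positive popularities $\mathcal D_p(q)$, summing to $1$, to his/her acceptable partners. He or she ranks them by successively drawing, without replacement, the next favourite with probability proportional to $\mathcal D_p$. A matching is stable if no man–woman pair prefer each other to their current partners and no one is matched to an unacceptable partner. A stable pair is a man–woman pair belonging to some stable matching. *)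

theory Defs
  imports "HOL-Probability.Probability" "HOL-Probability.Product_PMF"
begin

text \<open>
  The popularities of a person are given by a pmf \<open>D\<close> on the other side of the market;
  the acceptable partners are exactly its support, so that popularities of acceptable
  partners are positive and sum to 1, and \<open>d = card (set_pmf D)\<close>.
  A support inside a finite set of people is finite and, like every support of a pmf,
  nonempty, so \<open>d \<ge> 1\<close> holds automatically.
\<close>

text \<open>
  \<open>weighted_draws n D A\<close> draws \<open>n\<close> people successively and without replacement from \<open>A\<close>.
  Conditioning \<open>D\<close> on the set of remaining people is drawing with probability proportional
  to \<open>D\<close>; this is meaningful because the remaining set meets the support
  whenever \<open>A \<subseteq> set_pmf D\<close> and \<open>n \<le> card A\<close>.
\<close>

primrec weighted_draws :: "nat \<Rightarrow> 'a pmf \<Rightarrow> 'a set \<Rightarrow> 'a list pmf" where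
  "weighted_draws 0 D A = return_pmf []"
| "weighted_draws (Suc n) D A =
     bind_pmf (cond_pmf D A) (\<lambda>x.
       map_pmf (\<lambda>xs. x # xs) (weighted_draws n D (A - {x})))"

definition popularity_ranking :: "'a pmf \<Rightarrow> 'a list pmf" where
  "popularity_ranking D = weighted_draws (card (set_pmf D)) D (set_pmf D)"

text \<open>
  A preference list contains the acceptable partners, favourite first. An acceptable person
  is preferred to every unacceptable one.
\<close>

definition prefers :: "'a list \<Rightarrow> 'a \<Rightarrow> 'a \<Rightarrow> bool" where
  "prefers L x y \<longleftrightarrow> (\<exists>i<length L. L ! i = x \<and> y \<notin> set (take (Suc i) L))"

text \<open>
  \<open>S\<close> is the set of current partners (empty or a singleton): an unmatched
  person prefers every acceptable partner to staying single.
\<close>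

definition prefers_to_current :: "'a list \<Rightarrow> 'a \<Rightarrow> 'a set \<Rightarrow> bool" where
  "prefers_to_current L x S \<longleftrightarrow> x \<in> set L \<and> (\<forall>y\<in>S. prefers L x y)"

definition is_matching :: "'m set \<Rightarrow> 'w set \<Rightarrow> ('m \<times> 'w) set \<Rightarrow> bool" where
  "is_matching Men Women \<mu> \<longleftrightarrow>
     \<mu> \<subseteq> Men \<times> Women \<and> single_valued \<mu> \<and> single_valued (\<mu>\<inverse>)"

definition blocking_pair ::
  "('m \<Rightarrow> 'w list) \<Rightarrow> ('w \<Rightarrow> 'm list) \<Rightarrow> ('m \<times> 'w) set \<Rightarrow> 'm \<Rightarrow> 'w \<Rightarrow> bool" where
  "blocking_pair P Q \<mu> m w \<longleftrightarrow>
     prefers_to_current (P m) w (\<mu> `` {m}) \<and> prefers_to_current (Q w) m (\<mu>\<inverse> `` {w})"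

definition stable_matching ::
  "'m set \<Rightarrow> 'w set \<Rightarrow> ('m \<Rightarrow> 'w list) \<Rightarrow> ('w \<Rightarrow> 'm list) \<Rightarrow> ('m \<times> 'w) set \<Rightarrow> bool" where
  "stable_matching Men Women P Q \<mu> \<longleftrightarrow>
     is_matching Men Women \<mu> \<and>
     (\<forall>(m, w)\<in>\<mu>. w \<in> set (P m) \<and> m \<in> set (Q w)) \<and>
     \<not> (\<exists>m\<in>Men. \<exists>w\<in>Women. blocking_pair P Q \<mu> m w)"

definition stable_pairs ::
  "'m set \<Rightarrow> 'w set \<Rightarrow> ('m \<Rightarrow> 'w list) \<Rightarrow> ('w \<Rightarrow> 'm list) \<Rightarrow> ('m \<times> 'w) set" where
  "stable_pairs Men Women P Q =
     {(m, w). \<exists>\<mu>. stable_matching Men Women P Q \<mu> \<and> (m, w) \<in> \<mu>}"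

text \<open>All people draw their rankings independently; \<open>[]\<close> is a dummy value outside
  \<open>Men\<close> and \<open>Women\<close>.\<close>

definition random_profile ::
  "'m set \<Rightarrow> 'w set \<Rightarrow> ('m \<Rightarrow> 'w pmf) \<Rightarrow> ('w \<Rightarrow> 'm pmf)
     \<Rightarrow> (('m \<Rightarrow> 'w list) \<times> ('w \<Rightarrow> 'm list)) pmf" where
  "random_profile Men Women DM DW =
     pair_pmf (Pi_pmf Men [] (\<lambda>m. popularity_ranking (DM m)))
              (Pi_pmf Women [] (\<lambda>w. popularity_ranking (DW w)))"

definition expected_stable_pairs ::
  "'m set \<Rightarrow> 'w set \<Rightarrow> ('m \<Rightarrow> 'w pmf) \<Rightarrow> ('w \<Rightarrow> 'm pmf) \<Rightarrow> real" where
  "expected_stable_pairs Men Women DM DW =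
     measure_pmf.expectation (random_profile Men Women DM DW)
       (\<lambda>(P, Q). real (card (stable_pairs Men Women P Q)))"

end

theory Submission imports Defs begin

text \<open>
  Fix everybody's list except that of one person \<open>m\<close>. A possible partner \<open>t\<close> is stable iff \<open>m\<close> prefers
  \<open>t\<close> to a set \<open>C t\<close> of rivals not depending on the list of \<open>m\<close>, and \<open>C t\<close> contains \<open>s\<close> and \<open>C s\<close>
  unless \<open>t \<in> C s\<close>. Given the worst stable partner \<open>t\<close> and the relative order in
  \<open>B = insert t (C t)\<close>, the further stable partners are records of a fixed enumeration of
  \<open>A - B\<close>, where \<open>A\<close> is the set of possible partners, so their expected number is at most
  \<open>ln (D A / D B)\<close>. The best stable partner is the favourite in \<open>A\<close>. An entropy estimate then bounds the expectation of
  \<open>number - 1 - ln (D best / D worst)\<close> by \<open>ln (card (A - C t))\<close>, where \<open>card (A - C t)\<close> is at most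
  \<open>d\<^sub>m\<close> and also at most \<open>N\<close>, since every member of \<open>A - C t\<close> is matched in a stable matching containing \<open>(m, t)\<close>.
  Summing over both sides of the market, the logarithms cancel up to \<open>ln r\<close>, because in the
  optimal matching of one side everybody on the other side has their worst stable partner.
\<close>

section \<open>Preference lists\<close>

text \<open>The record bound \<open>ln (D A / D B)\<close> alone cannot suffice: it grows without
  limit as the members of \<open>B\<close> become unpopular. Subtracting
  \<open>ln (D best / D worst)\<close> removes this dependence, because the difference is at most an
  entropy, and an entropy sees only the number of atoms. The subtraction is nearly free, since one
  person's best partner is found again as a worst partner on the other side. The other obstacle is
  conditioning. Being the worst stable partner looks like an event about the whole list, and fixing
  it might bias all later comparisons. The nesting of the sets \<open>C t\<close> prevents this:
  once \<open>t\<close> is worst for one list, it is worst for every list with the same relative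
  order on \<open>B\<close>. Since successive proportional draws restricted to a subset are again
  such draws, the comparisons outside \<open>B\<close> keep their unconditional probabilities. Every
  stable pair is counted from both ends, whence the halves in the bound.\<close>

definition pref_rank :: "'a list \<Rightarrow> 'a \<Rightarrow> nat" where
  "pref_rank L x = length (takeWhile (\<lambda>z. z \<noteq> x) L)"

lemma pref_rank_le_length: "pref_rank L x \<le> length L"
  by (simp add: pref_rank_def length_takeWhile_le)

lemma pref_rank_less_iff: "pref_rank L x < length L \<longleftrightarrow> x \<in> set L"
proof
  assume "pref_rank L x < length L"
  then have "L ! pref_rank L x = x"
    unfolding pref_rank_def using nth_length_takeWhile by fastforce
  with \<open>pref_rank L x < length L\<close> show "x \<in> set L" by (metis nth_mem)
next
  assume "x \<in> set L"
  then show "pref_rank L x < length L"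
    unfolding pref_rank_def
    by (metis (mono_tags, lifting) le_neq_implies_less length_takeWhile_le set_takeWhileD takeWhile_eq_take take_all_iff order_refl)
qed

lemma nth_pref_rank: "x \<in> set L \<Longrightarrow> L ! pref_rank L x = x"
  using nth_length_takeWhile[of "\<lambda>z. z \<noteq> x" L] pref_rank_less_iff[of L x]
  by (simp add: pref_rank_def)

lemma pref_rank_inj: "x \<in> set L \<Longrightarrow> pref_rank L x = pref_rank L y \<Longrightarrow> x = y"
  by (metis nth_pref_rank pref_rank_less_iff)

lemma notin_take_pref_rank: "x \<notin> set (take (pref_rank L x) L)"
  unfolding pref_rank_def by (metis (mono_tags, lifting) set_takeWhileD takeWhile_eq_take)

text \<open>People absent from \<open>L\<close> all get rank \<open>length L\<close>: they are tied
  in last place, so none of them is preferred to anybody. Preference thus becomes a strict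
  comparison of numbers.\<close>

lemma prefers_iff_rank: "prefers L x y \<longleftrightarrow> pref_rank L x < pref_rank L y"
proof
  assume "prefers L x y"
  then obtain i where i: "i < length L" "L ! i = x" "y \<notin> set (take (Suc i) L)"
    unfolding prefers_def by blast
  have "pref_rank L x \<le> i"
  proof (rule ccontr)
    assume "\<not> pref_rank L x \<le> i"
    then have "x \<in> set (take (pref_rank L x) L)"
      using i by (auto simp: in_set_conv_nth intro!: exI[of _ i])
    then show False using notin_take_pref_rank by metis
  qed
  moreover have "i < pref_rank L y"
  proof (rule ccontr)
    assume *: "\<not> i < pref_rank L y"
    then have "y \<in> set L" using i pref_rank_less_iff[of L y] by linarith
    then have "take (Suc i) L ! pref_rank L y = y" using * nth_pref_rank[of y L] by simp
    moreover have "pref_rank L y < length (take (Suc i) L)" using * i by simp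
    ultimately show False using i(3) by (metis nth_mem)
  qed
  ultimately show "pref_rank L x < pref_rank L y" by simp
next
  assume *: "pref_rank L x < pref_rank L y"
  then have x: "x \<in> set L" using pref_rank_le_length[of L y] pref_rank_less_iff[of L x] by linarith
  have "set (take (Suc (pref_rank L x)) L) \<subseteq> set (take (pref_rank L y) L)"
    using * by (intro set_take_subset_set_take) simp
  then have "y \<notin> set (take (Suc (pref_rank L x)) L)" using notin_take_pref_rank[of y L] by blast
  moreover have "pref_rank L x < length L" "L ! pref_rank L x = x"
    using x pref_rank_less_iff[of L x] nth_pref_rank[of x L] by auto
  ultimately show "prefers L x y" unfolding prefers_def by blast
qed

lemma prefers_mem: "prefers L x y \<Longrightarrow> x \<in> set L"
  unfolding prefers_def by auto

lemma prefers_total: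
  "\<not> prefers L x y \<Longrightarrow> x \<noteq> y \<Longrightarrow> x \<in> set L \<Longrightarrow> prefers L y x"
  unfolding prefers_iff_rank using pref_rank_inj by (metis linorder_neqE_nat)

lemma prefers_irrefl: "\<not> prefers L x x"
  by (simp add: prefers_iff_rank)

lemma prefers_asym: "prefers L x y \<Longrightarrow> \<not> prefers L y x"
  by (simp add: prefers_iff_rank)

lemma prefers_trans: "prefers L x y \<Longrightarrow> prefers L y z \<Longrightarrow> prefers L x z"
  by (simp add: prefers_iff_rank)

lemma prefers_Cons: "prefers (a # L) x y \<longleftrightarrow> (if x = a then y \<noteq> a else y \<noteq> a \<and> prefers L x y)"
  by (auto simp: prefers_iff_rank pref_rank_def)

lemma not_prefers_Nil: "\<not> prefers [] x y"
  by (simp add: prefers_iff_rank pref_rank_def)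

section \<open>Stable matchings\<close>

lemma stable_matching_swap:
  "stable_matching Women Men Q P (\<mu>\<inverse>) \<longleftrightarrow> stable_matching Men Women P Q \<mu>"
  unfolding stable_matching_def is_matching_def blocking_pair_def by auto

lemma stable_pairs_swap: "stable_pairs Women Men Q P = (stable_pairs Men Women P Q)\<inverse>"
proof -
  have "(\<exists>\<mu>. stable_matching Women Men Q P \<mu> \<and> (w, m) \<in> \<mu>) \<longleftrightarrow>
        (\<exists>\<mu>. stable_matching Men Women P Q \<mu> \<and> (m, w) \<in> \<mu>)" for m w
    by (metis converse_iff stable_matching_swap)
  then show ?thesis unfolding stable_pairs_def by auto
qed

lemma stable_matchingD:
  assumes "stable_matching Men Women P Q \<mu>"
  shows "\<mu> \<subseteq> Men \<times> Women"
    and "(m, w) \<in> \<mu> \<Longrightarrow> (m, w') \<in> \<mu> \<Longrightarrow> w = w'"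
    and "(m, w) \<in> \<mu> \<Longrightarrow> (m', w) \<in> \<mu> \<Longrightarrow> m = m'"
    and "(m, w) \<in> \<mu> \<Longrightarrow> w \<in> set (P m)"
    and "(m, w) \<in> \<mu> \<Longrightarrow> m \<in> set (Q w)"
    and "m \<in> Men \<Longrightarrow> w \<in> Women \<Longrightarrow> \<not> blocking_pair P Q \<mu> m w"
  using assms unfolding stable_matching_def is_matching_def single_valued_def by fast+

text \<open>Since \<open>(m, w)\<close> does not block \<open>\<mu>\<^sub>2\<close>, the woman
  \<open>w\<close> has a partner there to whom she does not prefer \<open>m\<close>. He is not
  \<open>m\<close> himself, because \<open>m\<close> strictly prefers \<open>w\<close> to his own
  partner in \<open>\<mu>\<^sub>2\<close>.\<close>

lemma stable_partner_prefers_other: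
  assumes 1: "stable_matching Men Women P Q \<mu>\<^sub>1" and 2: "stable_matching Men Women P Q \<mu>\<^sub>2"
    and mw: "(m, w) \<in> \<mu>\<^sub>1" and pref: "prefers_to_current (P m) w (\<mu>\<^sub>2 `` {m})"
  shows "\<exists>m'. (m', w) \<in> \<mu>\<^sub>2 \<and> prefers_to_current (Q w) m' (\<mu>\<^sub>1\<inverse> `` {w})"
proof -
  note a = stable_matchingD[OF 1] and b = stable_matchingD[OF 2]
  have "\<not> prefers_to_current (Q w) m (\<mu>\<^sub>2\<inverse> `` {w})"
    using a(1) b(6) mw pref unfolding blocking_pair_def by blast
  then obtain m' where m': "(m', w) \<in> \<mu>\<^sub>2" "\<not> prefers (Q w) m m'"
    using a(5)[OF mw] unfolding prefers_to_current_def by auto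
  have "m' \<noteq> m" using pref m'(1) prefers_irrefl unfolding prefers_to_current_def by fastforce
  then have "prefers (Q w) m' m" using m' a(5)[OF mw] prefers_total by metis
  moreover have "\<mu>\<^sub>1\<inverse> `` {w} = {m}" using a(3) mw by blast
  ultimately show ?thesis using m'(1) prefers_mem unfolding prefers_to_current_def by fastforce
qed

text \<open>Opposition of interests. Following the two matchings alternately gives injections between the
  men who prefer \<open>\<mu>\<^sub>1\<close> and the women who prefer \<open>\<mu>\<^sub>2\<close> in both directions, hence bijections. In
  particular a person matched in one stable matching is matched in all of them.\<close>

lemma stable_opposition:
  assumes fin: "finite Men" "finite Women"
    and 1: "stable_matching Men Women P Q \<mu>\<^sub>1" and 2: "stable_matching Men Women P Q \<mu>\<^sub>2"
    and mw: "(m, w) \<in> \<mu>\<^sub>1" and pref: "prefers_to_current (P m) w (\<mu>\<^sub>2 `` {m})"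
  shows "\<exists>w'. (m, w') \<in> \<mu>\<^sub>2 \<and> prefers_to_current (Q w') m (\<mu>\<^sub>1\<inverse> `` {w'})"
proof -
  note a = stable_matchingD[OF 1] and b = stable_matchingD[OF 2]
  define M' where "M' = {m. \<exists>w. (m, w) \<in> \<mu>\<^sub>1 \<and> prefers_to_current (P m) w (\<mu>\<^sub>2 `` {m})}"
  define W' where "W' = {w. \<exists>m. (m, w) \<in> \<mu>\<^sub>2 \<and> prefers_to_current (Q w) m (\<mu>\<^sub>1\<inverse> `` {w})}"
  have finMW: "finite M'" "finite W'"
    using a(1) b(1) unfolding M'_def W'_def
    by (auto intro: finite_subset[OF _ fin(1)] finite_subset[OF _ fin(2)])
  have "\<forall>m\<in>M'. \<exists>w\<in>W'. (m, w) \<in> \<mu>\<^sub>1"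
    using stable_partner_prefers_other[OF 1 2] unfolding M'_def W'_def by blast
  then obtain f where f: "\<And>m. m \<in> M' \<Longrightarrow> f m \<in> W' \<and> (m, f m) \<in> \<mu>\<^sub>1" by metis
  have "inj_on f M'" using f a(3) by (metis inj_onI)
  then have le: "card M' \<le> card W'" using f finMW by (intro card_inj_on_le) auto
  have "\<forall>w\<in>W'. \<exists>m\<in>M'. (m, w) \<in> \<mu>\<^sub>2"
  proof
    fix w assume "w \<in> W'"
    then obtain m where "(m, w) \<in> \<mu>\<^sub>2" "prefers_to_current (Q w) m (\<mu>\<^sub>1\<inverse> `` {w})"
      unfolding W'_def by blast
    then obtain w\<^sub>1 where "(m, w) \<in> \<mu>\<^sub>2" "(w\<^sub>1, m) \<in> \<mu>\<^sub>1\<inverse>" "prefers_to_current (P m) w\<^sub>1 (\<mu>\<^sub>2 `` {m})"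
      using stable_partner_prefers_other[OF stable_matching_swap[THEN iffD2, OF 2] stable_matching_swap[THEN iffD2, OF 1], of w m]
      by auto
    then show "\<exists>m\<in>M'. (m, w) \<in> \<mu>\<^sub>2" unfolding M'_def by blast
  qed
  then obtain g where g: "\<And>w. w \<in> W' \<Longrightarrow> g w \<in> M' \<and> (g w, w) \<in> \<mu>\<^sub>2" by metis
  have "inj_on g W'" using g b(2) by (metis inj_onI)
  then have "card (g ` W') = card W'" by (rule card_image)
  moreover have "g ` W' \<subseteq> M'" using g by blast
  ultimately have "g ` W' = M'" using le by (intro card_seteq[OF finMW(1)]) simp_all
  moreover have "m \<in> M'" using mw pref unfolding M'_def by blast
  ultimately obtain w' where "w' \<in> W'" "(m, w') \<in> \<mu>\<^sub>2" using g by blast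
  then show ?thesis using b(3) unfolding W'_def by blast
qed

text \<open>The join in the lattice of stable matchings ordered by the women's preferences: every
  woman keeps the better of her two partners. Describing it by unbeaten pairs of the union makes it
  visibly symmetric and covers women who are single in one matching.\<close>

definition women_join :: "('w \<Rightarrow> 'm list) \<Rightarrow> ('m \<times> 'w) set \<Rightarrow> ('m \<times> 'w) set \<Rightarrow> ('m \<times> 'w) set" where
  "women_join Q \<mu>\<^sub>1 \<mu>\<^sub>2 =
     {(m, w) \<in> \<mu>\<^sub>1 \<union> \<mu>\<^sub>2. \<forall>m'. (m', w) \<in> \<mu>\<^sub>1 \<union> \<mu>\<^sub>2 \<longrightarrow> \<not> prefers (Q w) m' m}"

lemma women_join_commute: "women_join Q \<mu>\<^sub>1 \<mu>\<^sub>2 = women_join Q \<mu>\<^sub>2 \<mu>\<^sub>1"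
  unfolding women_join_def by (simp add: Un_commute)

lemma women_join_best:
  assumes 1: "stable_matching Men Women P Q \<mu>\<^sub>1" and 2: "stable_matching Men Women P Q \<mu>\<^sub>2"
    and "(m, w) \<in> \<mu>\<^sub>1 \<union> \<mu>\<^sub>2"
  shows "\<exists>m'. (m', w) \<in> women_join Q \<mu>\<^sub>1 \<mu>\<^sub>2 \<and> \<not> prefers (Q w) m m'"
proof -
  define m' where "m' = (ARG_MIN (pref_rank (Q w)) m'. (m', w) \<in> \<mu>\<^sub>1 \<union> \<mu>\<^sub>2)"
  have "(m', w) \<in> \<mu>\<^sub>1 \<union> \<mu>\<^sub>2" and "\<And>y. (y, w) \<in> \<mu>\<^sub>1 \<union> \<mu>\<^sub>2 \<Longrightarrow> pref_rank (Q w) m' \<le> pref_rank (Q w) y"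
    using arg_min_nat_lemma[of "\<lambda>m'. (m', w) \<in> \<mu>\<^sub>1 \<union> \<mu>\<^sub>2" m "pref_rank (Q w)"] assms(3)
    unfolding m'_def by auto
  then show ?thesis using assms(3) unfolding women_join_def prefers_iff_rank
    by (intro exI[of _ m']) force
qed

text \<open>A man who beats the better of two partners beats both. Commutativity of the join yields
  the same for \<open>\<mu>\<^sub>2\<close>.\<close>

lemma prefers_to_current_women_join:
  assumes "stable_matching Men Women P Q \<mu>\<^sub>1" "stable_matching Men Women P Q \<mu>\<^sub>2"
    and "prefers_to_current (Q w) m ((women_join Q \<mu>\<^sub>1 \<mu>\<^sub>2)\<inverse> `` {w})"
  shows "prefers_to_current (Q w) m (\<mu>\<^sub>1\<inverse> `` {w})"
  unfolding prefers_to_current_def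
proof (intro conjI ballI)
  show "m \<in> set (Q w)" using assms(3) unfolding prefers_to_current_def by blast
next
  fix y assume "y \<in> \<mu>\<^sub>1\<inverse> `` {w}"
  then obtain m' where "(m', w) \<in> women_join Q \<mu>\<^sub>1 \<mu>\<^sub>2" "\<not> prefers (Q w) y m'"
    using women_join_best[OF assms(1,2), of y w] by blast
  moreover from this(1) have "prefers (Q w) m m'"
    using assms(3) unfolding prefers_to_current_def by auto
  ultimately show "prefers (Q w) m y" unfolding prefers_iff_rank by linarith
qed

text \<open>A pair blocking the join would block one of the given matchings: the woman prefers the
  man to both of her partners, and the man's situation in the join is the one he has in
  \<open>\<mu>\<^sub>1\<close> or in \<open>\<mu>\<^sub>2\<close>. For a man single in the join this
  last claim needs \<open>stable_opposition\<close>.\<close>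

lemma stable_women_join:
  assumes fin: "finite Men" "finite Women"
    and 1: "stable_matching Men Women P Q \<mu>\<^sub>1" and 2: "stable_matching Men Women P Q \<mu>\<^sub>2"
  shows "stable_matching Men Women P Q (women_join Q \<mu>\<^sub>1 \<mu>\<^sub>2)" (is "stable_matching _ _ _ _ ?l")
proof -
  note a = stable_matchingD[OF 1] and b = stable_matchingD[OF 2]
  have sub: "?l \<subseteq> \<mu>\<^sub>1 \<union> \<mu>\<^sub>2" unfolding women_join_def by blast
  have acc: "\<forall>(m, w) \<in> ?l. w \<in> set (P m) \<and> m \<in> set (Q w)"
    using sub a(4,5) b(4,5) by blast
  have sv2: "m = m'" if "(m, w) \<in> ?l" "(m', w) \<in> ?l" for m m' w
    using that prefers_total[of "Q w" m m'] acc unfolding women_join_def by fastforce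
  \<comment> \<open>No man is chosen by two women: if he prefers \<open>w\<close>, his partner in
    \<open>\<mu>\<^sub>x\<close>, then stability of \<open>\<mu>\<^sub>y\<close> gives
    \<open>w\<close> a better partner there, so she would not have chosen him.\<close>
  have cross: False if h: "(m, w) \<in> ?l" "(m, w') \<in> ?l" "(m, w) \<in> \<mu>\<^sub>x" "(m, w') \<in> \<mu>\<^sub>y" "w \<noteq> w'"
      and x: "stable_matching Men Women P Q \<mu>\<^sub>x" and y: "stable_matching Men Women P Q \<mu>\<^sub>y"
      and xy: "\<mu>\<^sub>x \<union> \<mu>\<^sub>y = \<mu>\<^sub>1 \<union> \<mu>\<^sub>2" and pr: "prefers (P m) w w'" for m w w' \<mu>\<^sub>x \<mu>\<^sub>y
  proof -
    note x = stable_matchingD[OF x] and y = stable_matchingD[OF y]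
    have "\<mu>\<^sub>y `` {m} = {w'}" using h(4) y(2) by blast
    then have "prefers_to_current (P m) w (\<mu>\<^sub>y `` {m})"
      using pr x(4)[OF h(3)] unfolding prefers_to_current_def by simp
    then have "\<not> prefers_to_current (Q w) m (\<mu>\<^sub>y\<inverse> `` {w})"
      using y(6) x(1) h(3) unfolding blocking_pair_def by blast
    then obtain m2 where m2: "(m2, w) \<in> \<mu>\<^sub>y" "\<not> prefers (Q w) m m2"
      using x(5)[OF h(3)] unfolding prefers_to_current_def by auto
    have "m2 \<noteq> m" using m2 h y(2) by metis
    then have "prefers (Q w) m2 m" using m2 prefers_total x(5)[OF h(3)] by metis
    then show False using h(1) m2(1) xy unfolding women_join_def by blast
  qed
  have sv1: "w = w'" if "(m, w) \<in> ?l" "(m, w') \<in> ?l" for m w w'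
  proof (rule ccontr)
    assume ne: "w \<noteq> w'"
    have pr: "prefers (P m) w w' \<or> prefers (P m) w' w" using prefers_total ne acc that by fast
    have "(m, w) \<in> \<mu>\<^sub>1 \<and> (m, w') \<in> \<mu>\<^sub>2 \<or> (m, w) \<in> \<mu>\<^sub>2 \<and> (m, w') \<in> \<mu>\<^sub>1"
      using sub that ne a(2) b(2) by blast
    then show False
      using pr cross[of m w w' \<mu>\<^sub>1 \<mu>\<^sub>2] cross[of m w w' \<mu>\<^sub>2 \<mu>\<^sub>1] cross[of m w' w \<mu>\<^sub>1 \<mu>\<^sub>2]
        cross[of m w' w \<mu>\<^sub>2 \<mu>\<^sub>1] that ne 1 2 by (metis Un_commute)
  qed
  \<comment> \<open>If \<open>m\<close> were matched in both, the partner he likes less would, by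
    opposition of interests, keep him in the join; a common partner would keep him
    trivially.\<close>
  have single: "(\<mu>\<^sub>x `` {m} = {} \<or> \<mu>\<^sub>y `` {m} = {})"
    if none: "?l `` {m} = {}" and x: "stable_matching Men Women P Q \<mu>\<^sub>x"
      and y: "stable_matching Men Women P Q \<mu>\<^sub>y"
      and xy: "\<mu>\<^sub>x \<union> \<mu>\<^sub>y = \<mu>\<^sub>1 \<union> \<mu>\<^sub>2"
      and pr: "\<forall>w w'. (m, w) \<in> \<mu>\<^sub>x \<longrightarrow> (m, w') \<in> \<mu>\<^sub>y \<longrightarrow> w = w' \<or> prefers (P m) w w'" for m \<mu>\<^sub>x \<mu>\<^sub>y
  proof (rule ccontr)
    note X = stable_matchingD[OF x] and Y = stable_matchingD[OF y]
    assume "\<not> ?thesis"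
    then obtain w w' where w: "(m, w) \<in> \<mu>\<^sub>x" "(m, w') \<in> \<mu>\<^sub>y" by blast
    have im: "\<mu>\<^sub>y `` {m} = {w'}" using w Y(2) by blast
    have J: "(m, w) \<in> ?l \<longleftrightarrow> (m, w) \<in> \<mu>\<^sub>x \<union> \<mu>\<^sub>y \<and> (\<forall>m'. (m', w) \<in> \<mu>\<^sub>x \<union> \<mu>\<^sub>y \<longrightarrow> \<not> prefers (Q w) m' m)" for m w
      unfolding women_join_def xy by simp
    have ne: "w \<noteq> w'"
    proof
      assume "w = w'"
      then have "\<And>m'. (m', w) \<in> \<mu>\<^sub>x \<union> \<mu>\<^sub>y \<Longrightarrow> m' = m" using w X(3) Y(3) by blast
      then have "(m, w) \<in> ?l" using w prefers_irrefl unfolding J by fast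
      then show False using none by blast
    qed
    then have "prefers_to_current (P m) w (\<mu>\<^sub>y `` {m})"
      using pr w im prefers_mem unfolding prefers_to_current_def by fast
    from stable_opposition[OF fin x y w(1) this] have "prefers_to_current (Q w') m (\<mu>\<^sub>x\<inverse> `` {w'})"
      using Y(2) w(2) by metis
    then have "prefers (Q w') m m'" if "(m', w') \<in> \<mu>\<^sub>x" for m'
      using that unfolding prefers_to_current_def by blast
    then have "\<not> prefers (Q w') m' m" if "(m', w') \<in> \<mu>\<^sub>x \<union> \<mu>\<^sub>y" for m'
      using that Y(3)[OF w(2)] prefers_irrefl prefers_asym by (metis UnE)
    then have "(m, w') \<in> ?l" unfolding J using w(2) by blast
    then show False using none by blast
  qed
  have nb: "\<not> blocking_pair P Q ?l m w" if mw: "m \<in> Men" "w \<in> Women" for m w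
  proof
    assume blk: "blocking_pair P Q ?l m w"
    then have w1: "prefers_to_current (Q w) m (\<mu>\<^sub>1\<inverse> `` {w})"
      and w2: "prefers_to_current (Q w) m (\<mu>\<^sub>2\<inverse> `` {w})"
      using prefers_to_current_women_join[OF 1 2] prefers_to_current_women_join[OF 2 1]
      unfolding blocking_pair_def women_join_commute[of Q \<mu>\<^sub>2] by blast+
    have m0: "prefers_to_current (P m) w (?l `` {m})" using blk unfolding blocking_pair_def by blast
    have "prefers_to_current (P m) w (\<mu>\<^sub>1 `` {m}) \<or> prefers_to_current (P m) w (\<mu>\<^sub>2 `` {m})"
    proof (cases "?l `` {m} = {}")
      case False
      then obtain w' where w': "(m, w') \<in> ?l" by blast
      then have "\<mu>\<^sub>1 `` {m} = {w'} \<or> \<mu>\<^sub>2 `` {m} = {w'}" using sub a(2) b(2) by blast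
      then show ?thesis using m0 w' unfolding prefers_to_current_def by auto
    next
      case True
      have "(\<forall>w w'. (m, w) \<in> \<mu>\<^sub>1 \<longrightarrow> (m, w') \<in> \<mu>\<^sub>2 \<longrightarrow> w = w' \<or> prefers (P m) w w') \<or>
            (\<forall>w w'. (m, w) \<in> \<mu>\<^sub>2 \<longrightarrow> (m, w') \<in> \<mu>\<^sub>1 \<longrightarrow> w = w' \<or> prefers (P m) w w')"
        using a(2,4) b(2,4) prefers_total by metis
      then have "\<mu>\<^sub>1 `` {m} = {} \<or> \<mu>\<^sub>2 `` {m} = {}"
        using single[OF True 1 2] single[OF True 2 1] by blast
      then show ?thesis using m0 unfolding prefers_to_current_def by auto
    qed
    then show False using a(6) b(6) mw w1 w2 unfolding blocking_pair_def by blast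
  qed
  show ?thesis unfolding stable_matching_def is_matching_def single_valued_def
    using sub a(1) b(1) sv1 sv2 acc nb by (auto 0 4)
qed

section \<open>Existence of stable matchings\<close>

text \<open>Sotomayor's argument: among the matchings in which only single women belong to blocking pairs,
  a best one for the men is stable, since a single woman marrying her favourite blocking
  partner would improve it.\<close>

lemma stable_matching_exists:
  assumes fin: "finite Men" "finite Women"
  shows "\<exists>\<mu>. stable_matching Men Women P Q \<mu>"
proof -
  define simple where "simple \<mu> \<longleftrightarrow> is_matching Men Women \<mu> \<and>
     (\<forall>(m, w)\<in>\<mu>. w \<in> set (P m) \<and> m \<in> set (Q w)) \<and>
     (\<forall>m\<in>Men. \<forall>w\<in>Women. blocking_pair P Q \<mu> m w \<longrightarrow> \<mu>\<inverse> `` {w} = {})" for \<mu>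
  \<comment> \<open>An acceptable woman has value at least 1 for a man, and a better one has a
    larger value. Hence the total also grows when a single man marries.\<close>
  define val where "val = (\<lambda>(m, w). length (P m) - pref_rank (P m) w)"
  have "{\<mu>. simple \<mu>} \<subseteq> Pow (Men \<times> Women)" unfolding simple_def is_matching_def by blast
  then have finS: "finite {\<mu>. simple \<mu>}" using fin by (meson finite_Pow_iff finite_SigmaI finite_subset)
  have "simple {}" unfolding simple_def is_matching_def by simp
  then have "Max (sum val ` {\<mu>. simple \<mu>}) \<in> sum val ` {\<mu>. simple \<mu>}"
    using finS by (intro Max_in) auto
  then obtain \<mu> where mu: "simple \<mu>" and "sum val \<mu> = Max (sum val ` {\<mu>. simple \<mu>})" by auto
  then have max: "sum val \<nu> \<le> sum val \<mu>" if "simple \<nu>" for \<nu>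
    using that finS by simp
  have sub: "\<mu> \<subseteq> Men \<times> Women" and acc: "\<And>m w. (m, w) \<in> \<mu> \<Longrightarrow> w \<in> set (P m) \<and> m \<in> set (Q w)"
    and sv: "\<And>m w w'. (m, w) \<in> \<mu> \<Longrightarrow> (m, w') \<in> \<mu> \<Longrightarrow> w = w'"
    and sv': "\<And>m m' w. (m, w) \<in> \<mu> \<Longrightarrow> (m', w) \<in> \<mu> \<Longrightarrow> m = m'"
    and smp: "\<And>m w. m \<in> Men \<Longrightarrow> w \<in> Women \<Longrightarrow> blocking_pair P Q \<mu> m w \<Longrightarrow> \<mu>\<inverse> `` {w} = {}"
    using mu unfolding simple_def is_matching_def single_valued_def by fast+
  have "\<not> blocking_pair P Q \<mu> m\<^sub>0 w" if "m\<^sub>0 \<in> Men" "w \<in> Women" for m\<^sub>0 w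
  proof
    assume blk: "blocking_pair P Q \<mu> m\<^sub>0 w"
    define m where "m = (ARG_MIN (pref_rank (Q w)) m. m \<in> Men \<and> blocking_pair P Q \<mu> m w)"
    have m: "m \<in> Men" "blocking_pair P Q \<mu> m w"
      and best: "\<And>m'. m' \<in> Men \<Longrightarrow> blocking_pair P Q \<mu> m' w \<Longrightarrow> \<not> prefers (Q w) m' m"
      using arg_min_nat_lemma[of "\<lambda>m. m \<in> Men \<and> blocking_pair P Q \<mu> m w" m\<^sub>0 "pref_rank (Q w)"]
        that(1) blk unfolding m_def prefers_iff_rank by (auto simp: not_less)
    have free: "\<mu>\<inverse> `` {w} = {}" using smp that blk by blast
    have pm: "prefers_to_current (P m) w (\<mu> `` {m})" and mQ: "m \<in> set (Q w)"
      using m(2) unfolding blocking_pair_def prefers_to_current_def by auto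
    define \<nu> where "\<nu> = insert (m, w) (\<mu> - {m} \<times> UNIV)"
    have "simple \<nu>" unfolding simple_def
    proof (intro conjI ballI impI)
      show "is_matching Men Women \<nu>"
        using sub sv sv' free m(1) that(2) unfolding is_matching_def \<nu>_def single_valued_def by blast
      show "case x of (m, w) \<Rightarrow> w \<in> set (P m) \<and> m \<in> set (Q w)" if "x \<in> \<nu>" for x
        using that acc pm mQ unfolding \<nu>_def prefers_to_current_def by auto
      \<comment> \<open>A new blocking pair with \<open>w\<close> would contradict the choice of
        \<open>m\<close> as her favourite; with another matched woman it would have blocked
        \<open>\<mu>\<close> already, since the only man whose partner changes has improved.\<close>
      fix m2 w2 assume 2: "m2 \<in> Men" "w2 \<in> Women" "blocking_pair P Q \<nu> m2 w2"
      then have p2: "prefers_to_current (P m2) w2 (\<nu> `` {m2})"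
        and q2: "prefers_to_current (Q w2) m2 (\<nu>\<inverse> `` {w2})" unfolding blocking_pair_def by auto
      show "\<nu>\<inverse> `` {w2} = {}"
      proof (rule ccontr)
        assume "\<nu>\<inverse> `` {w2} \<noteq> {}"
        then obtain y where y: "(y, w2) \<in> \<nu>" by blast
        have eq: "\<nu> `` {m2} = \<mu> `` {m2}" if "m2 \<noteq> m" using that unfolding \<nu>_def by auto
        show False
        proof (cases "w2 = w")
          case True
          have "\<nu>\<inverse> `` {w2} = {m}" using True free unfolding \<nu>_def by auto
          then have pr: "prefers (Q w) m2 m" using q2 True unfolding prefers_to_current_def by simp
          then have "m2 \<noteq> m" using prefers_irrefl by metis
          then have "blocking_pair P Q \<mu> m2 w"
            using p2 q2 unfolding blocking_pair_def True eq[OF \<open>m2 \<noteq> m\<close>] free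
            by (simp add: prefers_to_current_def)
          then show False using best 2(1) pr by blast
        next
          case False
          then have yw: "(y, w2) \<in> \<mu>" "y \<noteq> m" using y unfolding \<nu>_def by auto
          have "\<mu>\<inverse> `` {w2} \<subseteq> \<nu>\<inverse> `` {w2}"
          proof
            fix z assume "z \<in> \<mu>\<inverse> `` {w2}"
            then have "z = y" using sv' yw(1) by blast
            then show "z \<in> \<nu>\<inverse> `` {w2}" using y by simp
          qed
          then have q3: "prefers_to_current (Q w2) m2 (\<mu>\<inverse> `` {w2})"
            using q2 unfolding prefers_to_current_def by blast
          have "prefers_to_current (P m2) w2 (\<mu> `` {m2})"
          proof (cases "m2 = m")
            case True
            have "\<nu> `` {m} = {w}" unfolding \<nu>_def by auto
            then have "prefers (P m) w2 w" using p2 True unfolding prefers_to_current_def by simp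
            then show ?thesis using pm True prefers_trans prefers_mem
              unfolding prefers_to_current_def by metis
          qed (use p2 eq in simp)
          then have "blocking_pair P Q \<mu> m2 w2" using q3 unfolding blocking_pair_def by blast
          then show False using smp[OF 2(1,2)] yw(1) by blast
        qed
      qed
    qed
    moreover have "sum val \<mu> < sum val \<nu>"
    proof -
      have finmu: "finite \<mu>" using sub fin by (meson finite_SigmaI finite_subset)
      have nw: "(m, w) \<notin> \<mu> - {m} \<times> UNIV" by simp
      have "sum val (\<mu> \<inter> {m} \<times> UNIV) < val (m, w)"
      proof (cases "\<mu> `` {m} = {}")
        case True
        then have "\<mu> \<inter> {m} \<times> UNIV = {}" by auto
        moreover have "w \<in> set (P m)" using pm unfolding prefers_to_current_def by blast
        ultimately show ?thesis using pref_rank_less_iff[of "P m" w] unfolding val_def by simp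
      next
        case False
        then obtain w' where w': "(m, w') \<in> \<mu>" by blast
        then have "\<mu> \<inter> {m} \<times> UNIV = {(m, w')}" using sv by auto
        moreover have "prefers (P m) w w'" using pm w' unfolding prefers_to_current_def by blast
        ultimately show ?thesis using acc[OF w'] pref_rank_less_iff[of "P m" w']
          unfolding val_def prefers_iff_rank by simp
      qed
      moreover have "sum val \<mu> = sum val (\<mu> \<inter> {m} \<times> UNIV) + sum val (\<mu> - {m} \<times> UNIV)"
        using finmu by (rule sum.Int_Diff)
      ultimately show ?thesis using finmu nw unfolding \<nu>_def by simp
    qed
    ultimately show False using max by fastforce
  qed
  then show ?thesis using mu unfolding stable_matching_def simple_def by blast
qed

section \<open>The stable partners of one person\<close>

text \<open>Only the list of \<open>m\<close> changes, so only pairs containing \<open>m\<close> can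
  start to block; the last hypothesis rules them out.\<close>

lemma stable_matching_change_list:
  assumes st: "stable_matching Men Women (P(m := L)) Q \<mu>"
    and "\<And>w. (m, w) \<in> \<mu> \<Longrightarrow> w \<in> set L'"
    and "\<And>c. prefers_to_current L' c (\<mu> `` {m}) \<Longrightarrow> prefers_to_current (Q c) m (\<mu>\<inverse> `` {c})
           \<Longrightarrow> prefers_to_current L c (\<mu> `` {m})"
  shows "stable_matching Men Women (P(m := L')) Q \<mu>"
  unfolding stable_matching_def
proof (intro conjI)
  show "is_matching Men Women \<mu>" using st unfolding stable_matching_def by blast
  show "\<forall>(m', w)\<in>\<mu>. w \<in> set ((P(m := L')) m') \<and> m' \<in> set (Q w)"
    using assms(2) stable_matchingD(4,5)[OF st] by fastforce
  show "\<not> (\<exists>m'\<in>Men. \<exists>w\<in>Women. blocking_pair (P(m := L')) Q \<mu> m' w)"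
    using assms(3) stable_matchingD(6)[OF st] unfolding blocking_pair_def
    by (metis fun_upd_apply)
qed

text \<open>A person \<open>m\<close> with a one-element list \<open>[t]\<close> tests whether \<open>t\<close> can be a stable partner at all.
  \<open>C t\<close> is the least possible set of women who prefer \<open>m\<close> to their own partner when \<open>m\<close> is matched
  to \<open>t\<close>; for the real list \<open>L\<close> of \<open>m\<close> only these women can block.\<close>

lemma stable_partners_structure:
  fixes P :: "'m \<Rightarrow> 'w list" and Q :: "'w \<Rightarrow> 'm list"
  assumes fin: "finite Men" "finite Women" and V: "V \<subseteq> Women" and m: "m \<in> Men"
  obtains A C where "A \<subseteq> V" and "\<And>t. t \<in> A \<Longrightarrow> C t \<subseteq> A - {t}"
    and "\<And>s t. s \<in> A \<Longrightarrow> t \<in> A \<Longrightarrow> s \<noteq> t \<Longrightarrow> t \<notin> C s \<Longrightarrow> insert s (C s) \<subseteq> C t"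
    and "\<And>t. t \<in> A \<Longrightarrow> card (A - C t) \<le> min (card Men) (card Women)"
    and "\<And>L. set L = V \<Longrightarrow>
      {w. (m, w) \<in> stable_pairs Men Women (P(m := L)) Q} = {t \<in> A. \<forall>c\<in>C t. prefers L t c}"
proof -
  let ?st = "\<lambda>L. stable_matching Men Women (P(m := L)) Q"
  \<comment> \<open>The acceptable women who would accept \<open>m\<close> in place of their
    situation in \<open>\<mu>\<close>. Whether they block is then up to the list of
    \<open>m\<close>.\<close>
  define E where "E \<mu> = {c \<in> V. prefers_to_current (Q c) m (\<mu>\<inverse> `` {c})}" for \<mu>
  define A where "A = {t \<in> V. \<exists>\<mu>. ?st [t] \<mu> \<and> (m, t) \<in> \<mu>}"
  have finV: "finite V" using V fin(2) finite_subset by blast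
  have finE: "finite (E \<mu>)" for \<mu> using finV unfolding E_def by simp
  have im: "\<mu> `` {m} = {t}" if "?st L \<mu>" "(m, t) \<in> \<mu>" for L \<mu> t
    using that stable_matchingD(2)[OF that(1)] by blast
  have down: "?st [t] \<mu>" if "?st L \<mu>" "(m, t) \<in> \<mu>" for L \<mu> t
    using that(2) im[OF that]
    by (intro stable_matching_change_list[OF that(1)]) (auto simp: prefers_to_current_def prefers_irrefl)
  have up: "?st L \<mu>" if "?st [t] \<mu>" "(m, t) \<in> \<mu>" "t \<in> set L" "set L \<subseteq> V"
      "\<And>c. c \<in> set L \<Longrightarrow> c \<in> E \<mu> \<Longrightarrow> prefers L t c" for L \<mu> t
  proof (rule stable_matching_change_list[OF that(1)])
    fix c assume "prefers_to_current L c (\<mu> `` {m})" "prefers_to_current (Q c) m (\<mu>\<inverse> `` {c})"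
    then have "prefers L c t" "c \<in> set L" "c \<in> E \<mu>"
      using im[OF that(1,2)] that(4) unfolding E_def prefers_to_current_def by auto
    then show "prefers_to_current [t] c (\<mu> `` {m})" using that(5) prefers_asym by metis
  qed (use im[OF that(1,2)] that(3) in auto)
  have notE: "t \<notin> E \<mu>" if "(m, t) \<in> \<mu>" for t \<mu>
    using that prefers_irrefl unfolding E_def prefers_to_current_def by fastforce
  have join_E: "E (women_join Q \<mu>\<^sub>1 \<mu>\<^sub>2) \<subseteq> E \<mu>\<^sub>1 \<inter> E \<mu>\<^sub>2" if "?st L \<mu>\<^sub>1" "?st L \<mu>\<^sub>2" for L \<mu>\<^sub>1 \<mu>\<^sub>2
    using prefers_to_current_women_join[OF that] prefers_to_current_women_join[OF that(2,1)]
    unfolding E_def women_join_commute[of Q \<mu>\<^sub>2] by auto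
  have "\<exists>\<nu>. ?st [t] \<nu> \<and> (m, t) \<in> \<nu> \<and> (\<forall>\<mu>. ?st [t] \<mu> \<longrightarrow> (m, t) \<in> \<mu> \<longrightarrow> E \<nu> \<subseteq> E \<mu>)" if tA: "t \<in> A" for t
  proof -
    define \<nu> where "\<nu> = (ARG_MIN (\<lambda>\<mu>. card (E \<mu>)) \<mu>. ?st [t] \<mu> \<and> (m, t) \<in> \<mu>)"
    obtain \<mu>\<^sub>0 where "?st [t] \<mu>\<^sub>0 \<and> (m, t) \<in> \<mu>\<^sub>0" using tA unfolding A_def by blast
    from arg_min_nat_lemma[of "\<lambda>\<mu>. ?st [t] \<mu> \<and> (m, t) \<in> \<mu>", OF this, of "\<lambda>\<mu>. card (E \<mu>)"]
    have nu: "?st [t] \<nu>" "(m, t) \<in> \<nu>"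
      and min: "\<And>\<mu>. ?st [t] \<mu> \<Longrightarrow> (m, t) \<in> \<mu> \<Longrightarrow> card (E \<nu>) \<le> card (E \<mu>)"
      unfolding \<nu>_def by auto
    \<comment> \<open>Minimal cardinality gives a least set: the join with any competitor still
      contains \<open>(m, t)\<close>, since \<open>t\<close> has the same partner in both, and its
      \<open>E\<close> lies in both sets.\<close>
    have "E \<nu> \<subseteq> E \<mu>" if mu: "?st [t] \<mu>" "(m, t) \<in> \<mu>" for \<mu>
    proof -
      let ?l = "women_join Q \<nu> \<mu>"
      have "?st [t] ?l" by (rule stable_women_join[OF fin nu(1) mu(1)])
      moreover have "(m, t) \<in> ?l"
        using stable_matchingD(3)[OF mu(1) mu(2)] stable_matchingD(3)[OF nu(1) nu(2)] nu(2) prefers_irrefl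
        unfolding women_join_def by fast
      ultimately have "card (E \<nu>) \<le> card (E ?l)" by (rule min)
      then have "E ?l = E \<nu>" using join_E[OF nu(1) mu(1)] by (intro card_seteq[OF finE]) auto
      then show ?thesis using join_E[OF nu(1) mu(1)] by blast
    qed
    then show ?thesis using nu by blast
  qed
  then obtain \<nu> where nu: "\<And>t. t \<in> A \<Longrightarrow> ?st [t] (\<nu> t)" "\<And>t. t \<in> A \<Longrightarrow> (m, t) \<in> \<nu> t"
    and least: "\<And>t \<mu>. t \<in> A \<Longrightarrow> ?st [t] \<mu> \<Longrightarrow> (m, t) \<in> \<mu> \<Longrightarrow> E (\<nu> t) \<subseteq> E \<mu>"
    by metis
  define C where "C t = E (\<nu> t)" for t
  have CA: "C t \<subseteq> A - {t}" if t: "t \<in> A" for t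
  proof
    fix c assume c: "c \<in> C t"
    have ct: "c \<noteq> t" using c notE[OF nu(2)[OF t]] unfolding C_def by blast
    have cV: "c \<in> V" using c unfolding C_def E_def by blast
    have tV: "t \<in> V" using t unfolding A_def by blast
    \<comment> \<open>The list \<open>[c, t]\<close> forces the pair \<open>(m, c)\<close>: if
      \<open>m\<close> got \<open>t\<close>, then \<open>c\<close> would still want him and block;
      if he stayed single, \<open>\<kappa>\<close> would be stable for \<open>[t]\<close> as well,
      although he is matched in another stable matching for \<open>[t]\<close>.\<close>
    obtain \<kappa> where k: "?st [c, t] \<kappa>" using stable_matching_exists[OF fin] by blast
    have "(m, c) \<in> \<kappa>"
    proof (rule ccontr)
      assume nc: "(m, c) \<notin> \<kappa>"
      have mc: "w = t" if "(m, w) \<in> \<kappa>" for w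
        using stable_matchingD(4)[OF k that] nc that by auto
      show False
      proof (cases "(m, t) \<in> \<kappa>")
        case True
        then have "C t \<subseteq> E \<kappa>" using least[OF t down[OF k True] True] unfolding C_def by blast
        then have "prefers_to_current (Q c) m (\<kappa>\<inverse> `` {c})" using c unfolding E_def by blast
        moreover have "prefers_to_current [c, t] c (\<kappa> `` {m})"
          using mc ct unfolding prefers_to_current_def by (auto simp: prefers_Cons)
        ultimately show False
          using stable_matchingD(6)[OF k m] cV V unfolding blocking_pair_def by auto
      next
        case False
        then have none: "\<kappa> `` {m} = {}" using mc by blast
        have "?st [t] \<kappa>"
          by (rule stable_matching_change_list[OF k]) (use none in \<open>auto simp: prefers_to_current_def\<close>)
        moreover have "prefers_to_current ((P(m := [t])) m) t (\<kappa> `` {m})"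
          using none by (simp add: prefers_to_current_def)
        ultimately have "\<exists>w. (m, w) \<in> \<kappa>"
          using stable_opposition[OF fin nu(1)[OF t] _ nu(2)[OF t]] by blast
        then show False using none by blast
      qed
    qed
    then have "c \<in> A" using down[OF k] cV unfolding A_def by blast
    then show "c \<in> A - {t}" using ct by blast
  qed
  have chain: "insert s (C s) \<subseteq> C t" if s: "s \<in> A" and t: "t \<in> A" and ne: "s \<noteq> t" and nC: "t \<notin> C s" for s t
  proof -
    have stV: "s \<in> V" "t \<in> V" using s t unfolding A_def by auto
    \<comment> \<open>With the list \<open>[t, s]\<close> both matchings are stable and
      \<open>m\<close> prefers \<open>\<nu> t\<close>. Opposition makes \<open>s\<close> prefer
      \<open>m\<close> to her situation in \<open>\<nu> t\<close>, so \<open>s\<close> lies in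
      \<open>C t\<close>. It also puts \<open>(m, s)\<close> into the join, and leastness of
      \<open>C s\<close> then gives the inclusion in \<open>C t\<close>.\<close>
    have S: "?st [t, s] (\<nu> s)"
      by (rule up[OF nu(1)[OF s] nu(2)[OF s]]) (use stV nC notE[OF nu(2)[OF s]] in \<open>auto simp: C_def\<close>)
    have T: "?st [t, s] (\<nu> t)"
      by (rule up[OF nu(1)[OF t] nu(2)[OF t]])
        (use stV ne notE[OF nu(2)[OF t]] in \<open>auto simp: C_def prefers_Cons\<close>)
    have "prefers_to_current ((P(m := [t, s])) m) t (\<nu> s `` {m})"
      using im[OF S nu(2)[OF s]] ne by (simp add: prefers_to_current_def prefers_Cons)
    from stable_opposition[OF fin T S nu(2)[OF t] this]
    obtain w where "(m, w) \<in> \<nu> s" "prefers_to_current (Q w) m ((\<nu> t)\<inverse> `` {w})" by blast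
    moreover have "w = s" if "(m, w) \<in> \<nu> s" for w using that im[OF S nu(2)[OF s]] by blast
    ultimately have sp: "prefers_to_current (Q s) m ((\<nu> t)\<inverse> `` {s})" by metis
    let ?l = "women_join Q (\<nu> s) (\<nu> t)"
    have "\<not> prefers (Q s) m' m" if "(m', s) \<in> \<nu> s \<union> \<nu> t" for m'
    proof (cases "(m', s) \<in> \<nu> s")
      case True
      then show ?thesis using stable_matchingD(3)[OF S nu(2)[OF s]] prefers_irrefl by metis
    next
      case False
      then have "prefers (Q s) m m'" using that sp unfolding prefers_to_current_def by simp
      then show ?thesis by (rule prefers_asym)
    qed
    then have l: "(m, s) \<in> ?l" using nu(2)[OF s] unfolding women_join_def by blast
    have "?st [s] ?l" using down[OF stable_women_join[OF fin S T] l] .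
    then have "C s \<subseteq> E ?l" using least[OF s _ l] unfolding C_def by blast
    then have "C s \<subseteq> C t" using join_E[OF S T] unfolding C_def by blast
    moreover have "s \<in> C t" using sp stV unfolding C_def E_def by blast
    ultimately show ?thesis by blast
  qed
  have bound: "card (A - C t) \<le> min (card Men) (card Women)" if t: "t \<in> A" for t
  proof -
    note n = stable_matchingD[OF nu(1)[OF t]]
    have "\<exists>m'. (m', w) \<in> \<nu> t" if w: "w \<in> A - C t" for w
    proof -
      \<comment> \<open>Membership in \<open>A\<close> makes \<open>m\<close> acceptable to
        \<open>w\<close>; a single \<open>w\<close> would therefore want him and belong to
        \<open>C t\<close>.\<close>
      have "w \<in> V" "m \<in> set (Q w)" using w stable_matchingD(5)[OF nu(1) nu(2), of w] unfolding A_def by auto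
      then show ?thesis using w unfolding C_def E_def prefers_to_current_def by auto
    qed
    then obtain f where f: "\<And>w. w \<in> A - C t \<Longrightarrow> (f w, w) \<in> \<nu> t" by metis
    have "inj_on f (A - C t)" using f n(2) by (metis inj_onI)
    moreover have "f ` (A - C t) \<subseteq> Men" using f n(1) by blast
    ultimately have "card (A - C t) \<le> card Men" using fin(1) by (rule card_inj_on_le)
    moreover have "card (A - C t) \<le> card Women"
      using V fin(2) unfolding A_def by (intro card_mono) auto
    ultimately show ?thesis by simp
  qed
  have char: "{w. (m, w) \<in> stable_pairs Men Women (P(m := L)) Q} = {t \<in> A. \<forall>c\<in>C t. prefers L t c}"
    if L: "set L = V" for L
  proof (intro equalityI subsetI)
    fix t assume "t \<in> {w. (m, w) \<in> stable_pairs Men Women (P(m := L)) Q}"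
    then obtain \<mu> where mu: "?st L \<mu>" "(m, t) \<in> \<mu>" unfolding stable_pairs_def by blast
    have t: "t \<in> V" using stable_matchingD(4)[OF mu] L by simp
    then have tA: "t \<in> A" using down[OF mu] mu(2) unfolding A_def by blast
    have "prefers L t c" if "c \<in> C t" for c
    proof -
      have cE: "c \<in> E \<mu>" using that least[OF tA down[OF mu] mu(2)] unfolding C_def by blast
      then have c: "c \<in> V" "prefers_to_current (Q c) m (\<mu>\<inverse> `` {c})" unfolding E_def by auto
      then have "\<not> prefers_to_current L c {t}"
        using stable_matchingD(6)[OF mu(1) m, of c] V im[OF mu] unfolding blocking_pair_def by auto
      then have "\<not> prefers L c t" using c L unfolding prefers_to_current_def by blast
      moreover have "c \<noteq> t" using cE notE mu(2) by blast
      ultimately show ?thesis using prefers_total c L by metis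
    qed
    then show "t \<in> {t \<in> A. \<forall>c\<in>C t. prefers L t c}" using tA by blast
  next
    fix t assume "t \<in> {t \<in> A. \<forall>c\<in>C t. prefers L t c}"
    then have t: "t \<in> A" "\<And>c. c \<in> C t \<Longrightarrow> prefers L t c" by auto
    then have "?st L (\<nu> t)"
      using L by (intro up[OF nu(1)[OF t(1)] nu(2)[OF t(1)]]) (auto simp: C_def A_def)
    then show "t \<in> {w. (m, w) \<in> stable_pairs Men Women (P(m := L)) Q}"
      using nu(2)[OF t(1)] unfolding stable_pairs_def by blast
  qed
  have "A \<subseteq> V" unfolding A_def by blast
  from that[OF this CA chain bound char] show ?thesis by blast
qed

section \<open>Successive draws without replacement\<close>

lemma weighted_draws_step:
  assumes "finite S" "S \<noteq> {}" "S \<subseteq> set_pmf D"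
  shows "weighted_draws (card S) D S = bind_pmf (cond_pmf D S)
    (\<lambda>x. map_pmf ((#) x) (weighted_draws (card (S - {x})) D (S - {x})))"
proof -
  obtain n where n: "card S = Suc n" using assms(1,2) by (metis card_0_eq not0_implies_Suc)
  have "set_pmf (cond_pmf D S) = S" using assms by (subst set_cond_pmf) auto
  then show ?thesis unfolding n weighted_draws.simps
    using n assms(1) by (intro bind_pmf_cong refl) (auto simp: card_Diff_singleton)
qed

lemma set_weighted_draws:
  assumes "finite S" "S \<subseteq> set_pmf D" "L \<in> set_pmf (weighted_draws (card S) D S)"
  shows "set L = S \<and> distinct L"
  using assms
proof (induction "card S" arbitrary: S L)
  case 0
  then show ?case by simp
next
  case (Suc n)
  then have ne: "S \<noteq> {}" by auto
  have "set_pmf (cond_pmf D S) = S" using Suc.prems ne by (subst set_cond_pmf) auto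
  then obtain x l where x: "x \<in> S" "L = x # l" "l \<in> set_pmf (weighted_draws (card (S - {x})) D (S - {x}))"
    using Suc.prems(3) unfolding weighted_draws_step[OF Suc.prems(1) ne Suc.prems(2)] by auto
  have "set l = S - {x} \<and> distinct l"
    using Suc.hyps(2) Suc.prems(1,2) x by (intro Suc.hyps(1)) auto
  then show ?case using x by auto
qed

lemma finite_set_weighted_draws:
  assumes "finite S" "S \<subseteq> set_pmf D"
  shows "finite (set_pmf (weighted_draws (card S) D S))"
  using set_weighted_draws[OF assms]
  by (intro finite_subset[OF _ finite_subset_distinct[OF assms(1)]]) auto

text \<open>Draw from \<open>S\<close>, and after a miss of \<open>C\<close> draw afresh from
  \<open>C\<close>. The chance of \<open>y\<close> in \<open>C\<close> is
  \<open>D y / D S + (1 - D C / D S) * D y / D C\<close>, which is \<open>D y / D C\<close>. The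
  continuation \<open>f\<close> enters only through associativity.\<close>

lemma bind_cond_pmf_redraw:
  assumes fin: "finite S" and S: "S \<subseteq> set_pmf D" and C: "C \<subseteq> S" "C \<noteq> {}"
  shows "bind_pmf (cond_pmf D S) (\<lambda>x. if x \<in> C then f x else bind_pmf (cond_pmf D C) f)
      = bind_pmf (cond_pmf D C) f"
proof -
  let ?R = "cond_pmf D C" and ?p = "\<lambda>T. sum (pmf D) T"
  have finC: "finite C" using C(1) fin finite_subset by blast
  have pos: "?p T > 0" if "T \<subseteq> S" "T \<noteq> {}" for T
    using that S finite_subset[OF that(1) fin] by (intro sum_pos) (auto simp: pmf_positive subset_iff)
  have pS: "pmf (cond_pmf D S) y = (if y \<in> S then pmf D y / ?p S else 0)" for y
    using C S by (subst pmf_cond) (auto simp: measure_measure_pmf_finite fin)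
  have pC: "pmf ?R y = (if y \<in> C then pmf D y / ?p C else 0)" for y
    using C S by (subst pmf_cond) (auto simp: measure_measure_pmf_finite finC)
  have finS: "finite (set_pmf (cond_pmf D S))"
    using fin C S by (subst set_cond_pmf) auto
  have "measure (cond_pmf D S) C = ?p C / ?p S"
    using C(1) by (simp add: measure_measure_pmf_finite[OF finC] pS sum_divide_distrib subset_iff)
  then have mC: "measure (cond_pmf D S) (- C) = 1 - ?p C / ?p S"
    using measure_pmf.prob_compl[of C "cond_pmf D S"] by (simp add: Compl_eq_Diff_UNIV)
  have "bind_pmf (cond_pmf D S) (\<lambda>x. if x \<in> C then return_pmf x else ?R) = ?R"
  proof (rule pmf_eqI)
    fix y
    have "pmf (bind_pmf (cond_pmf D S) (\<lambda>x. if x \<in> C then return_pmf x else ?R)) y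
        = measure_pmf.expectation (cond_pmf D S)
            (\<lambda>x. indicator (C \<inter> {y}) x + indicator (- C) x * pmf ?R y)"
      unfolding pmf_bind by (intro Bochner_Integration.integral_cong) (auto simp: indicator_def)
    also have "\<dots> = measure (cond_pmf D S) (C \<inter> {y}) + measure (cond_pmf D S) (- C) * pmf ?R y"
      by (subst Bochner_Integration.integral_add)
        (auto intro!: integrable_measure_pmf_finite finS)
    also have "\<dots> = pmf ?R y"
    proof (cases "y \<in> C")
      case True
      then have "C \<inter> {y} = {y}" by auto
      then show ?thesis using True C pos[of S] pos[of C]
        by (auto simp: mC pC pS measure_pmf_single subset_iff field_simps)
    qed (simp add: pC)
    finally show "pmf (bind_pmf (cond_pmf D S) (\<lambda>x. if x \<in> C then return_pmf x else ?R)) y = pmf ?R y" .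
  qed
  then have "bind_pmf ?R f = bind_pmf (bind_pmf (cond_pmf D S) (\<lambda>x. if x \<in> C then return_pmf x else ?R)) f"
    by simp
  also have "\<dots> = bind_pmf (cond_pmf D S) (\<lambda>x. if x \<in> C then f x else bind_pmf ?R f)"
    unfolding bind_assoc_pmf by (intro bind_pmf_cong refl) (simp add: bind_return_pmf)
  finally show ?thesis by simp
qed

text \<open>Luce's independence of irrelevant alternatives. A draw outside \<open>C\<close> is
  invisible after filtering and leaves, by induction, a fresh ranking of \<open>C\<close>;
  \<open>bind_cond_pmf_redraw\<close> absorbs it.\<close>

lemma filter_weighted_draws:
  assumes "finite S" "S \<subseteq> set_pmf D" "C \<subseteq> S"
  shows "map_pmf (filter (\<lambda>x. x \<in> C)) (weighted_draws (card S) D S) = weighted_draws (card C) D C"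
  using assms
proof (induction "card S" arbitrary: S C)
  case 0
  then show ?case by simp
next
  case (Suc n)
  then have ne: "S \<noteq> {}" by auto
  have sS: "set_pmf (cond_pmf D S) = S" using Suc.prems ne by (subst set_cond_pmf) auto
  show ?case
  proof (cases "C = {}")
    case True
    then have "filter (\<lambda>x. x \<in> C) = (\<lambda>_. [])" by (auto simp: fun_eq_iff)
    then show ?thesis using True by simp
  next
    case False
    let ?f = "\<lambda>x. map_pmf ((#) x) (weighted_draws (card (C - {x})) D (C - {x}))"
    have finC: "finite C" "C \<subseteq> set_pmf D" using Suc.prems finite_subset by auto
    have "map_pmf (filter (\<lambda>x. x \<in> C)) (weighted_draws (card S) D S) =
      bind_pmf (cond_pmf D S) (\<lambda>x. map_pmf (filter (\<lambda>x. x \<in> C)) (map_pmf ((#) x) (weighted_draws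
          (card (S - {x})) D (S - {x}))))"
      unfolding weighted_draws_step[OF Suc.prems(1) ne Suc.prems(2)] map_bind_pmf ..
    also have "\<dots> = bind_pmf (cond_pmf D S) (\<lambda>x. if x \<in> C then ?f x else bind_pmf (cond_pmf D C) ?f)"
    proof (intro bind_pmf_cong refl)
      fix x assume "x \<in> set_pmf (cond_pmf D S)"
      then have x: "x \<in> S" using sS by blast
      have n: "n = card (S - {x})" using Suc.hyps(2) x Suc.prems(1) by simp
      let ?w = "weighted_draws (card (S - {x})) D (S - {x})"
      have set: "set L = S - {x}" if "L \<in> set_pmf ?w" for L
        using set_weighted_draws[OF _ _ that] Suc.prems by auto
      have "map_pmf (filter (\<lambda>y. y \<in> C)) (map_pmf ((#) x) ?w) =
         map_pmf (\<lambda>l. if x \<in> C then x # l else l) (map_pmf (filter (\<lambda>y. y \<in> C - {x})) ?w)"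
        unfolding pmf.map_comp
        by (intro map_pmf_cong refl) (auto dest!: set intro!: filter_cong)
      also have "map_pmf (filter (\<lambda>y. y \<in> C - {x})) ?w = weighted_draws (card (C - {x})) D (C - {x})"
        by (rule Suc.hyps(1)[OF n]) (use Suc.prems in auto)
      finally show "map_pmf (filter (\<lambda>y. y \<in> C)) (map_pmf ((#) x) ?w)
          = (if x \<in> C then ?f x else bind_pmf (cond_pmf D C) ?f)"
        using weighted_draws_step[OF finC(1) False finC(2)] by (auto simp: pmf.map_id)
    qed
    also have "\<dots> = bind_pmf (cond_pmf D C) ?f"
      by (rule bind_cond_pmf_redraw[OF Suc.prems False])
    also have "\<dots> = weighted_draws (card C) D C"
      by (rule weighted_draws_step[OF finC(1) False finC(2), symmetric])
    finally show ?thesis .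
  qed
qed

section \<open>Events determined by a restricted ranking\<close>

lemma hd_filter_eq_iff:
  assumes "x \<in> set L" "x \<in> S"
  shows "hd (filter (\<lambda>y. y \<in> S) L) = x \<longleftrightarrow> (\<forall>c\<in>S - {x}. prefers L x c)"
  using assms by (induction L) (auto simp: prefers_Cons)

lemma prefers_filter:
  assumes "x \<in> S" "y \<in> S"
  shows "prefers (filter (\<lambda>z. z \<in> S) L) x y \<longleftrightarrow> prefers L x y"
  using assms by (induction L) (auto simp: prefers_Cons not_prefers_Nil)

text \<open>Beating all of \<open>C\<close> means heading the ranking restricted to
  \<open>insert x C\<close>. Given this head, the remainder is a fresh ranking of \<open>C\<close>,
  so its restriction to \<open>B\<close> has its unconditional law: the two events are
  independent.\<close>

lemma prob_filter_and_beats: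
  assumes fin: "finite V" and V: "V \<subseteq> set_pmf D" and B: "B \<subseteq> C" and C: "insert x C \<subseteq> V" and x: "x \<notin> C"
  shows "measure (weighted_draws (card V) D V) {L. filter (\<lambda>y. y \<in> B) L = \<sigma> \<and> (\<forall>c\<in>C. prefers L x c)}
    = pmf (weighted_draws (card B) D B) \<sigma> * (pmf D x / sum (pmf D) (insert x C))"
proof -
  let ?C = "insert x C" and ?w = "\<lambda>S. weighted_draws (card S) D S"
  have fC: "finite ?C" "?C \<subseteq> set_pmf D" using fin V C finite_subset by auto
  have sC: "set_pmf (cond_pmf D ?C) = ?C" using fC by (subst set_cond_pmf) auto
  have "measure (?w V) {L. filter (\<lambda>y. y \<in> B) L = \<sigma> \<and> (\<forall>c\<in>C. prefers L x c)}
      = measure (?w V) ((\<lambda>L. (hd (filter (\<lambda>y. y \<in> ?C) L), filter (\<lambda>y. y \<in> B) (filter (\<lambda>y. y \<in> ?C) L)))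
          -` {(x, \<sigma>)})"
  proof (rule measure_pmf.finite_measure_eq_AE)
    have "filter (\<lambda>y. y \<in> B) (filter (\<lambda>y. y \<in> ?C) L) = filter (\<lambda>y. y \<in> B) L" for L
      using B by (auto intro!: filter_cong)
    moreover have "hd (filter (\<lambda>y. y \<in> ?C) L) = x \<longleftrightarrow> (\<forall>c\<in>C. prefers L x c)" if "L \<in> set_pmf (?w V)" for L
      using hd_filter_eq_iff[of x L ?C] set_weighted_draws[OF fin V that] C x by auto
    ultimately show "AE L in measure_pmf (?w V). (L \<in> {L. filter (\<lambda>y. y \<in> B) L = \<sigma> \<and> (\<forall>c\<in>C. prefers L x c)}) =
      (L \<in> (\<lambda>L. (hd (filter (\<lambda>y. y \<in> ?C) L), filter (\<lambda>y. y \<in> B) (filter (\<lambda>y. y \<in> ?C) L))) -` {(x, \<sigma>)})"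
      by (auto simp: AE_measure_pmf_iff)
  qed simp_all
  also have "\<dots> = pmf (map_pmf (\<lambda>L. (hd L, filter (\<lambda>y. y \<in> B) L)) (map_pmf (filter (\<lambda>y. y \<in> ?C)) (?w V)))
      (x, \<sigma>)"
    unfolding pmf.map_comp pmf_map by (simp add: comp_def)
  also have "map_pmf (filter (\<lambda>y. y \<in> ?C)) (?w V) = ?w ?C"
    by (rule filter_weighted_draws[OF fin V C])
  also have "map_pmf (\<lambda>L. (hd L, filter (\<lambda>y. y \<in> B) L)) (?w ?C) =
     bind_pmf (cond_pmf D ?C) (\<lambda>y. map_pmf (\<lambda>l. (y, filter (\<lambda>y. y \<in> B) (y # l))) (?w (?C - {y})))"
    by (subst weighted_draws_step[OF fC(1) _ fC(2)]) (simp_all add: map_bind_pmf pmf.map_comp comp_def)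
  also have "pmf \<dots> (x, \<sigma>) = measure_pmf.expectation (cond_pmf D ?C) (\<lambda>y. indicator {x} y * pmf (?w B) \<sigma>)"
    unfolding pmf_bind
  proof (intro Bochner_Integration.integral_cong refl)
    fix y
    show "pmf (map_pmf (\<lambda>l. (y, filter (\<lambda>y. y \<in> B) (y # l))) (?w (?C - {y}))) (x, \<sigma>)
        = indicator {x} y * pmf (?w B) \<sigma>"
    proof (cases "y = x")
      case True
      have "x \<notin> B" using B x by blast
      then have "(\<lambda>l. (x, filter (\<lambda>y. y \<in> B) (x # l))) -` {(x, \<sigma>)} = filter (\<lambda>y. y \<in> B) -` {\<sigma>}" by auto
      moreover have "?C - {x} = C" using x by simp
      moreover have "map_pmf (filter (\<lambda>y. y \<in> B)) (?w C) = ?w B"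
        using fC B by (intro filter_weighted_draws) auto
      ultimately show ?thesis using True by (simp add: pmf_map flip: \<open>map_pmf _ (?w C) = ?w B\<close>)
    next
      case False
      then have "(\<lambda>l. (y, filter (\<lambda>y. y \<in> B) (y # l))) -` {(x, \<sigma>)} = {}" by auto
      then show ?thesis using False by (simp add: pmf_map)
    qed
  qed
  also have "\<dots> = pmf (cond_pmf D ?C) x * pmf (?w B) \<sigma>"
    by (simp add: measure_pmf_single)
  also have "pmf (cond_pmf D ?C) x = pmf D x / sum (pmf D) ?C"
    using fC by (subst pmf_cond) (auto simp: measure_measure_pmf_finite)
  finally show ?thesis by (simp add: mult.commute)
qed

section \<open>Surplus, records and entropy\<close>

definition favourites :: "'a list \<Rightarrow> 'a set \<Rightarrow> 'a set" where
  "favourites L S = {x \<in> S. \<forall>y\<in>S. \<not> prefers L y x}"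

text \<open>Like \<open>favourites\<close>, a set instead of an element: sums over it vanish for a
  person without stable partners, and over all people these sets form a relation whose edges can be
  summed from either side.\<close>

definition least_favourites :: "'a list \<Rightarrow> 'a set \<Rightarrow> 'a set" where
  "least_favourites L S = {x \<in> S. \<forall>y\<in>S. \<not> prefers L x y}"

text \<open>For nonempty \<open>S \<subseteq> set L\<close> with best element \<open>b\<close> and worst element \<open>c\<close> this is
  \<open>card S - 1 - ln (D b / D c)\<close>; it is \<open>0\<close> for empty \<open>S\<close>.\<close>

definition surplus :: "'a pmf \<Rightarrow> 'a list \<Rightarrow> 'a set \<Rightarrow> real" where
  "surplus D L S = real (card S) - real (card (favourites L S))
     - (\<Sum>x\<in>favourites L S. ln (pmf D x)) + (\<Sum>x\<in>least_favourites L S. ln (pmf D x))"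

lemma favourites_singleton:
  assumes "x \<in> S" "\<And>y. y \<in> S \<Longrightarrow> y \<noteq> x \<Longrightarrow> prefers L x y"
  shows "favourites L S = {x}"
  unfolding favourites_def using assms prefers_asym prefers_irrefl by fast

lemma least_favourites_singleton:
  assumes "x \<in> S" "\<And>y. y \<in> S \<Longrightarrow> y \<noteq> x \<Longrightarrow> prefers L y x"
  shows "least_favourites L S = {x}"
  unfolding least_favourites_def using assms prefers_asym prefers_irrefl by fast

lemma favourite_exists:
  assumes "S \<noteq> {}" "S \<subseteq> set L"
  obtains x where "x \<in> S" "\<And>y. y \<in> S \<Longrightarrow> y \<noteq> x \<Longrightarrow> prefers L x y"
proof -
  obtain z where z: "z \<in> S" using assms(1) by blast
  define x where "x = (ARG_MIN (pref_rank L) x. x \<in> S)"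
  have x: "x \<in> S" "\<And>y. y \<in> S \<Longrightarrow> \<not> prefers L y x"
    using arg_min_nat_lemma[of "\<lambda>x. x \<in> S" z "pref_rank L", OF z]
    unfolding x_def prefers_iff_rank by (auto simp: not_less)
  show thesis using that[OF x(1)] x(2) prefers_total assms(2) by (metis subsetD)
qed

lemma least_favourite_exists:
  assumes "S \<noteq> {}" "S \<subseteq> set L"
  obtains x where "x \<in> S" "\<And>y. y \<in> S \<Longrightarrow> y \<noteq> x \<Longrightarrow> prefers L y x"
proof -
  have fin: "finite S" using assms(2) finite_subset by blast
  have "Max (pref_rank L ` S) \<in> pref_rank L ` S" using assms(1) fin by (intro Max_in) auto
  then obtain x where x: "x \<in> S" "pref_rank L x = Max (pref_rank L ` S)" by (elim imageE) simp
  have "\<not> prefers L x y" if "y \<in> S" for y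
    using that fin unfolding prefers_iff_rank x(2) by (simp add: not_less)
  then show thesis using that[OF x(1)] x(1) prefers_total assms(2) by (metis subsetD)
qed

text \<open>If \<open>c\<close> is the weight before \<open>x\<close> is added, then
  \<open>p x / (c + p x)\<close> is at most \<open>ln (c + p x) - ln c\<close>, by
  \<open>ln u \<le> u - 1\<close> at \<open>u = c / (c + p x)\<close>. These differences
  telescope.\<close>

lemma sum_record_probabilities_le_ln:
  assumes "sum p B > (0::real)" "finite B" "distinct xs" "set xs \<inter> B = {}" "\<And>x. x \<in> set xs \<Longrightarrow> p x > 0"
  shows "(\<Sum>i<length xs. p (xs ! i) / sum p (insert (xs ! i) (B \<union> set (take i xs))))
    \<le> ln (sum p (B \<union> set xs) / sum p B)"
  using assms(3-)
proof (induction xs rule: rev_induct)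
  case Nil
  then show ?case using assms(1) by simp
next
  case (snoc x xs)
  let ?C = "B \<union> set xs"
  have eq: "sum p (insert x ?C) = sum p ?C + p x" using snoc.prems assms(2) by simp
  have C: "sum p ?C \<ge> sum p B" using snoc.prems assms(2)
    by (intro sum_mono2) (auto intro: less_imp_le)
  then have C0: "sum p ?C > 0" using assms(1) by linarith
  have px: "p x > 0" using snoc.prems by simp
  have "- (p x / (sum p ?C + p x)) \<ge> ln (sum p ?C / (sum p ?C + p x))"
    using ln_le_minus_one[of "sum p ?C / (sum p ?C + p x)"] C0 px by (simp add: field_simps)
  then have "p x / sum p (insert x ?C) \<le> ln (sum p ?C + p x) - ln (sum p ?C)"
    unfolding eq using C0 px by (simp add: ln_div)
  moreover have "(\<Sum>i<length xs. p ((xs @ [x]) ! i) / sum p (insert ((xs @ [x]) ! i)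
      (B \<union> set (take i (xs @ [x])))))
      \<le> ln (sum p ?C / sum p B)"
    using snoc by (simp add: nth_append)
  ultimately have "(\<Sum>i<length (xs @ [x]). p ((xs @ [x]) ! i) / sum p (insert ((xs @ [x]) ! i)
      (B \<union> set (take i (xs @ [x])))))
     \<le> ln (sum p ?C / sum p B) + (ln (sum p ?C + p x) - ln (sum p ?C))"
    by simp
  also have "\<dots> = ln (sum p (B \<union> set (xs @ [x])) / sum p B)"
    using C0 px assms(1) eq by (simp add: ln_div)
  finally show ?case .
qed

text \<open>The bound of entropy by \<open>ln n\<close>, atom by atom, from the tangent of the
  logarithm at 1. Over \<open>n\<close> atoms of total mass 1 the corrections
  \<open>1 / n - a\<close> add up to 0.\<close>

lemma neg_mult_ln_le:
  assumes "a > (0::real)" "n > 0"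
  shows "- (a * ln a) \<le> a * ln n + (1 / n - a)"
proof -
  have "ln (1 / (a * n)) \<le> 1 / (a * n) - 1" using assms by (intro ln_le_minus_one) simp
  then have "a * ln (1 / (a * n)) \<le> a * (1 / (a * n) - 1)" using assms by simp
  moreover have "a * ln (1 / (a * n)) = - (a * ln a) - a * ln n"
    using assms by (simp add: ln_div ln_mult algebra_simps)
  moreover have "a * (1 / (a * n) - 1) = 1 / n - a" using assms by (simp add: field_simps)
  ultimately show ?thesis by linarith
qed

text \<open>After replacing \<open>q\<close> by \<open>sum p B\<close>, the left-hand side is the entropy of the distribution with
  \<open>card X + 1\<close> atoms that \<open>p\<close> induces when \<open>B\<close> is collapsed to a point.\<close>

lemma collapsed_entropy_le:
  assumes B: "finite B" "sum p B > (0::real)" and X: "finite X" "X \<inter> B = {}"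
    and pos: "\<And>x. x \<in> X \<Longrightarrow> p x > 0" and q: "0 < q" "q \<le> sum p B"
  shows "ln (sum p (B \<union> X) / sum p B) - (\<Sum>x\<in>X. p x / sum p (B \<union> X) * (ln (p x) - ln q))
      \<le> ln (real (Suc (card X)))"
proof -
  define P where "P = sum p (B \<union> X)"
  define b where "b = sum p B"
  define n where "n = real (Suc (card X))"
  have Pb: "P = b + sum p X" unfolding P_def b_def using B X by (intro sum.union_disjoint) auto
  have "sum p X \<ge> 0" using pos by (intro sum_nonneg) (auto intro: less_imp_le)
  then have P0: "P > 0" and b0: "b > 0" using Pb B unfolding b_def by auto
  have n0: "n > 0" unfolding n_def by simp
  have one: "b / P + (\<Sum>x\<in>X. p x / P) = 1"
    using P0 by (simp add: sum_divide_distrib[symmetric] add_divide_distrib[symmetric] Pb[symmetric])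
  \<comment> \<open>Raising \<open>q\<close> to \<open>b\<close> only decreases the subtracted sum;
    afterwards the expression is exactly an entropy.\<close>
  have "(\<Sum>x\<in>X. p x / P * (ln (p x) - ln q)) \<ge> (\<Sum>x\<in>X. p x / P * (ln (p x) - ln b))"
    using q pos P0 b0 by (intro sum_mono mult_left_mono) (auto simp: b_def intro: less_imp_le)
  moreover have "(\<Sum>x\<in>X. p x / P * (ln (p x) - ln b)) = (\<Sum>x\<in>X. p x / P * ln (p x / P)) +
      (\<Sum>x\<in>X. p x / P) * (ln P - ln b)"
    unfolding sum_distrib_right sum.distrib[symmetric]
    using pos P0 by (intro sum.cong) (auto simp: ln_div algebra_simps diff_divide_distrib)
  ultimately have "ln (P / b) - (\<Sum>x\<in>X. p x / P * (ln (p x) - ln q))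
      \<le> (1 - (\<Sum>x\<in>X. p x / P)) * (ln P - ln b) - (\<Sum>x\<in>X. p x / P * ln (p x / P))"
    using P0 b0 by (simp add: ln_div algebra_simps)
  also have "\<dots> = - (b / P * ln (b / P)) + (\<Sum>x\<in>X. - (p x / P * ln (p x / P)))"
    using one P0 b0 by (simp add: ln_div sum_negf algebra_simps flip: one)
  also have "\<dots> \<le> (b / P * ln n + (1 / n - b / P)) + (\<Sum>x\<in>X. p x / P * ln n + (1 / n - p x / P))"
    using P0 b0 n0 pos by (intro add_mono sum_mono neg_mult_ln_le) auto
  also have "\<dots> = (b / P + (\<Sum>x\<in>X. p x / P)) * ln n + (real (Suc (card X)) / n - (b / P + (\<Sum>x\<in>X. p x / P)))"
    by (simp add: sum.distrib sum_subtractf sum_distrib_left algebra_simps add_divide_distrib)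
  also have "\<dots> = ln n" unfolding one using n0 by (simp add: n_def)
  finally show ?thesis unfolding P_def b_def n_def .
qed

text \<open>Condition on the worst stable partner \<open>t\<close> and on the relative order of \<open>insert t (C t)\<close>. The
  remaining possible partners, sorted by the size of their \<open>C\<close>, are stable only if they beat
  all earlier ones, so their expected number is a sum of record probabilities.\<close>

lemma expectation_surplus_le:
  fixes D :: "'a pmf" and k :: real
  assumes fin: "finite (set_pmf D)" and A: "A \<subseteq> set_pmf D" "A \<noteq> {}"
    and CA: "\<And>t. t \<in> A \<Longrightarrow> C t \<subseteq> A - {t}"
    and chain: "\<And>s t. s \<in> A \<Longrightarrow> t \<in> A \<Longrightarrow> s \<noteq> t \<Longrightarrow> t \<notin> C s \<Longrightarrow> insert s (C s) \<subseteq> C t"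
    and k: "\<And>t. t \<in> A \<Longrightarrow> real (card (A - C t)) \<le> k"
  shows "measure_pmf.expectation (popularity_ranking D) (\<lambda>L. surplus D L {t \<in> A. \<forall>c\<in>C t. prefers L t c})
      \<le> ln k"
proof -
  define W where "W = popularity_ranking D"
  define S where "S L = {t \<in> A. \<forall>c\<in>C t. prefers L t c}" for L
  have W: "W = weighted_draws (card (set_pmf D)) D (set_pmf D)" unfolding W_def popularity_ranking_def ..
  have finW: "finite (set_pmf W)" unfolding W using finite_set_weighted_draws[OF fin] by simp
  have setL: "set L = set_pmf D" if "L \<in> set_pmf W" for L
    using set_weighted_draws[OF fin order_refl] that unfolding W by blast
  have finA: "finite A" using A fin finite_subset by blast
  have SA: "S L \<subseteq> A" for L unfolding S_def by blast
  define worst where "worst L = (THE t. least_favourites L (S L) = {t})" for L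
  define b where "b L = insert (worst L) (C (worst L))" for L
  \<comment> \<open>The information conditioned on: the set \<open>B\<close> and the relative order
    in it.\<close>
  define g where "g L = (b L, filter (\<lambda>x. x \<in> b L) L)" for L
  have top: "\<exists>x. x \<in> S L \<and> (\<forall>y\<in>A - {x}. prefers L x y)" if L: "L \<in> set_pmf W" for L
  proof -
    obtain x where "x \<in> A" "\<And>y. y \<in> A \<Longrightarrow> y \<noteq> x \<Longrightarrow> prefers L x y"
      using favourite_exists[of A L] A setL[OF L] by blast
    then show ?thesis using CA unfolding S_def by blast
  qed
  have worst: "least_favourites L (S L) = {worst L} \<and> worst L \<in> S L
      \<and> (\<forall>y\<in>S L - {worst L}. prefers L y (worst L))"
    if L: "L \<in> set_pmf W" for L
  proof -
    have SL: "S L \<subseteq> set L" "S L \<noteq> {}" using SA A(1) setL[OF L] top[OF L] by auto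
    obtain x where x: "x \<in> S L" "\<And>y. y \<in> S L \<Longrightarrow> y \<noteq> x \<Longrightarrow> prefers L y x"
      using least_favourite_exists[OF SL(2,1)] by blast
    have "least_favourites L (S L) = {x}" by (rule least_favourites_singleton[OF x(1) x(2)])
    moreover from this have "worst L = x" unfolding worst_def by auto
    ultimately show ?thesis using x by auto
  qed
  have fibre: "(\<Sum>L | L \<in> set_pmf W \<and> g L = g L0. pmf W L * surplus D L (S L))
      \<le> (\<Sum>L | L \<in> set_pmf W \<and> g L = g L0. pmf W L * ln k)" if L0: "L0 \<in> set_pmf W" for L0
  proof -
    define t where "t = worst L0"
    define B where "B = insert t (C t)"
    define \<sigma> where "\<sigma> = filter (\<lambda>x. x \<in> B) L0"
    define F where "F = {L \<in> set_pmf W. filter (\<lambda>x. x \<in> B) L = \<sigma>}"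
    define X where "X = A - B"
    have t0: "t \<in> S L0" "\<And>y. y \<in> S L0 \<Longrightarrow> y \<noteq> t \<Longrightarrow> prefers L0 y t" using worst[OF L0] unfolding t_def by auto
    have tA: "t \<in> A" using t0 SA by blast
    have BA: "B \<subseteq> A" "finite B" "t \<notin> C t" using CA[OF tA] tA finA unfolding B_def
        by (auto intro: finite_subset)
    have X: "finite X" "X \<inter> B = {}" "A = B \<union> X" using BA finA unfolding X_def by auto
    have same: "prefers L x y \<longleftrightarrow> prefers L0 x y" if "L \<in> F" "x \<in> B" "y \<in> B" for L x y
    proof -
      have "filter (\<lambda>x. x \<in> B) L = filter (\<lambda>x. x \<in> B) L0" using that(1) unfolding F_def \<sigma>_def by simp
      then show ?thesis using prefers_filter[OF that(2,3)] by metis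
    qed
    have FW: "L \<in> set_pmf W" if "L \<in> F" for L using that unfolding F_def by blast
    have tS: "t \<in> S L" if "L \<in> F" for L
      using t0(1) same[OF that] unfolding S_def B_def by blast
    \<comment> \<open>If \<open>s\<close> were stable for \<open>L\<close> without being preferred
      to \<open>t\<close>, then \<open>t\<close> would not be in \<open>C s\<close>, so
      \<open>s\<close> and \<open>C s\<close> would lie in \<open>B\<close>. The order on
      \<open>B\<close>, shared with \<open>L0\<close>, would make \<open>s\<close> stable for
      \<open>L0\<close> too, where \<open>t\<close> is worst.\<close>
    have t_worst: "prefers L s t" if L: "L \<in> F" and s: "s \<in> S L" "s \<noteq> t" for L s
    proof (rule ccontr)
      assume n: "\<not> prefers L s t"
      have sA: "s \<in> A" using s SA by blast
      then have "s \<in> set L" using A(1) setL[OF FW[OF L]] by blast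
      then have "t \<notin> C s" using s n unfolding S_def by blast
      then have sub: "insert s (C s) \<subseteq> B" using chain[OF sA tA s(2)] unfolding B_def by blast
      then have "s \<in> S L0" using s(1) same[OF L] unfolding S_def by blast
      then have "prefers L0 s t" using t0(2) s(2) by blast
      then show False using n same[OF L] sub unfolding B_def by blast
    qed
    have least: "least_favourites L (S L) = {t}" if L: "L \<in> F" for L
      by (rule least_favourites_singleton[OF tS[OF L] t_worst[OF L]])
    have gF: "{L. L \<in> set_pmf W \<and> g L = g L0} = F"
    proof (intro equalityI subsetI)
      fix L assume "L \<in> F"
      moreover from this have "worst L = t" using least worst FW by (metis singleton_inject)
      then have "b L = B" "b L0 = B" unfolding b_def B_def t_def by auto
      ultimately show "L \<in> {L. L \<in> set_pmf W \<and> g L = g L0}"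
        unfolding g_def F_def \<sigma>_def by simp
    next
      fix L assume L: "L \<in> {L. L \<in> set_pmf W \<and> g L = g L0}"
      then have "b L = b L0" "filter (\<lambda>x. x \<in> b L) L = filter (\<lambda>x. x \<in> b L0) L0" by (auto simp: g_def)
      moreover have "b L0 = B" unfolding b_def B_def t_def ..
      ultimately show "L \<in> F" using L unfolding F_def \<sigma>_def by simp
    qed
    obtain ys where ys: "set ys = X" "distinct ys" using finite_distinct_list[OF X(1)] by blast
    define xs where "xs = sort_key (\<lambda>x. card (C x)) ys"
    have xs: "set xs = X" "distinct xs" "sorted (map (\<lambda>x. card (C x)) xs)"
      using ys unfolding xs_def by auto
    define R where "R i L \<longleftrightarrow> (\<forall>c\<in>B \<union> set (take i xs). prefers L (xs ! i) c)" for i L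
    define U where "U x L \<longleftrightarrow> (\<forall>c\<in>A - {x}. prefers L x c)" for x L
    have rec: "R i L" if L: "L \<in> F" and i: "i < length xs" "xs ! i \<in> S L" for i L
      unfolding R_def
    proof
      fix c assume c: "c \<in> B \<union> set (take i xs)"
      have iX: "xs ! i \<in> X" using i(1) xs(1) nth_mem by blast
      have it: "xs ! i \<noteq> t" using iX X(2) unfolding B_def by blast
      have pt: "prefers L (xs ! i) t" by (rule t_worst[OF L i(2) it])
      consider "c = t" | "c \<in> C t" | j where "j < i" "c = xs ! j"
        using c i(1) unfolding B_def by (auto simp: in_set_conv_nth)
      then show "prefers L (xs ! i) c"
      proof cases
        case 2
        then have "prefers L t c" using tS[OF L] unfolding S_def by blast
        then show ?thesis using pt prefers_trans by metis
      next
        case 3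
        have jX: "xs ! j \<in> X" using 3(1) i(1) xs(1) nth_mem by (metis less_trans)
        have ne: "xs ! j \<noteq> xs ! i" using xs(2) 3(1) i(1) by (simp add: nth_eq_iff_index_eq)
        have le: "card (C (xs ! j)) \<le> card (C (xs ! i))"
          using sorted_nth_mono[OF xs(3), of j i] 3(1) i(1) by simp
        have iA: "xs ! i \<in> A" "xs ! j \<in> A" using iX jX X(3) by auto
        \<comment> \<open>Otherwise \<open>C (xs ! j)\<close> would contain
          \<open>C (xs ! i)\<close> and the further element \<open>xs ! i\<close>, against the
          sorting by cardinality.\<close>
        have "xs ! j \<in> C (xs ! i)"
        proof (rule ccontr)
          assume "xs ! j \<notin> C (xs ! i)"
          then have sub: "insert (xs ! i) (C (xs ! i)) \<subseteq> C (xs ! j)" using chain[OF iA] ne by metis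
          have "finite (C (xs ! j))" using CA[OF iA(2)] finA finite_subset by blast
          then have "card (insert (xs ! i) (C (xs ! i))) \<le> card (C (xs ! j))" using sub card_mono by blast
          moreover have "finite (C (xs ! i))" "xs ! i \<notin> C (xs ! i)"
              using CA[OF iA(1)] finA finite_subset by blast+
          ultimately show False using le by simp
        qed
        then show ?thesis using i(2) 3(2) unfolding S_def by blast
      qed (use pt in simp)
    qed
    have card_le: "real (card (S L)) \<le> 1 + (\<Sum>i<length xs. of_bool (R i L))" if L: "L \<in> F" for L
    proof -
      \<comment> \<open>Members of \<open>C t\<close> are beaten by \<open>t\<close>, hence are not
        stable when \<open>t\<close> is worst. Only \<open>t\<close> itself, the summand 1, and
        records in \<open>X\<close> remain.\<close>
      have "S L \<subseteq> insert t ((\<lambda>i. xs ! i) ` {i. i < length xs \<and> R i L})"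
      proof
        fix s assume s: "s \<in> S L"
        have "s \<notin> C t"
        proof
          assume c: "s \<in> C t"
          then have "prefers L t s" using tS[OF L] unfolding S_def by blast
          moreover have "prefers L s t" using t_worst[OF L s] c BA(3) by metis
          ultimately show False using prefers_asym by metis
        qed
        then have "s = t \<or> s \<in> X" using s SA unfolding X_def B_def by blast
        then show "s \<in> insert t ((\<lambda>i. xs ! i) ` {i. i < length xs \<and> R i L})"
          using rec[OF L] s xs(1) by (auto simp: in_set_conv_nth)
      qed
      then have "card (S L) \<le> card (insert t ((\<lambda>i. xs ! i) ` {i. i < length xs \<and> R i L}))"
        by (intro card_mono) auto
      also have "\<dots> \<le> Suc (card ((\<lambda>i. xs ! i) ` {i. i < length xs \<and> R i L}))"
          by (rule card_insert_le_m1) simp_all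
      also have "\<dots> \<le> Suc (card {i. i < length xs \<and> R i L})" by (simp add: card_image_le)
      finally have "real (card (S L)) \<le> 1 + real (card {i. i < length xs \<and> R i L})" by linarith
      also have "real (card {i. i < length xs \<and> R i L}) = (\<Sum>i<length xs. of_bool (R i L))"
        by (simp add: Int_def lessThan_def conj_commute)
      finally show ?thesis .
    qed
    \<comment> \<open>The favourite in \<open>A\<close> is either a member of \<open>X\<close> or
      \<open>t\<close> itself, as \<open>t\<close> beats \<open>C t\<close>. If it is
      \<open>t\<close>, the sum over \<open>X\<close> is empty of contributions and the log ratio is
      0.\<close>
    have fav: "(\<Sum>x\<in>favourites L (S L). ln (pmf D x)) = ln (pmf D t) + (\<Sum>x\<in>X. of_bool (U x L) *
        (ln (pmf D x) - ln (pmf D t)))"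
      and cardfav: "card (favourites L (S L)) = 1" if L: "L \<in> F" for L
    proof -
      obtain x where x: "x \<in> S L" "\<And>y. y \<in> A \<Longrightarrow> y \<noteq> x \<Longrightarrow> prefers L x y" using top[OF FW[OF L]] by blast
      have fx: "favourites L (S L) = {x}"
        by (rule favourites_singleton[OF x(1)]) (use x(2) SA in blast)
      then show "card (favourites L (S L)) = 1" by simp
      have xA: "x \<in> A" using x(1) SA by blast
      have Ux: "U y L \<longleftrightarrow> y = x" if "y \<in> A" for y
      proof
        assume U: "U y L"
        show "y = x"
        proof (rule ccontr)
          assume ne: "y \<noteq> x"
          then have "prefers L y x" using U xA unfolding U_def by simp
          then show False using x(2)[OF that ne] prefers_asym by metis
        qed
      next
        assume "y = x"
        then show "U y L" using x(2) unfolding U_def by simp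
      qed
      have "(\<Sum>y\<in>X. of_bool (U y L) * (ln (pmf D y) - ln (pmf D t))) =
          (\<Sum>y\<in>X. if y = x then ln (pmf D x) - ln (pmf D t) else 0)"
        using Ux X(3) by (intro sum.cong) auto
      also have "\<dots> = ln (pmf D x) - ln (pmf D t)"
      proof (cases "x \<in> X")
        case False
        then have "x \<in> B" using xA X(3) by blast
        moreover have "x \<notin> C t"
        proof
          assume c: "x \<in> C t"
          then have "prefers L t x" using tS[OF L] unfolding S_def by blast
          moreover have "prefers L x t" using x(2)[OF tA] c BA(3) by metis
          ultimately show False using prefers_asym by metis
        qed
        ultimately have "x = t" unfolding B_def by blast
        then show ?thesis using X(1) by simp
      qed (use X(1) in simp)
      finally show "(\<Sum>x\<in>favourites L (S L). ln (pmf D x)) = ln (pmf D t) + (\<Sum>x\<in>X. of_bool (U x L) *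
          (ln (pmf D x) - ln (pmf D t)))"
        unfolding fx by simp
    qed
    have Z: "surplus D L (S L) \<le> (\<Sum>i<length xs. of_bool (R i L))
        - (\<Sum>x\<in>X. of_bool (U x L) * (ln (pmf D x) - ln (pmf D t)))"
      if L: "L \<in> F" for L
      using card_le[OF L] unfolding surplus_def fav[OF L] cardfav[OF L] least[OF L] by simp
    \<comment> \<open>The probability of the fibre. It factors out of the probabilities of all
      events \<open>R i\<close> and \<open>U x\<close>.\<close>
    define q where "q = pmf (weighted_draws (card B) D B) \<sigma>"
    have finF: "finite F" using finW unfolding F_def by simp
    have sum_prob: "(\<Sum>L\<in>F. pmf W L * of_bool (Pr L)) = measure W {L. filter (\<lambda>x. x \<in> B) L = \<sigma> \<and> Pr L}" for Pr
    proof -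
      have "(\<Sum>L\<in>F. pmf W L * of_bool (Pr L)) = (\<Sum>L\<in>{L\<in>F. Pr L}. pmf W L)"
        using finF by (intro sum.mono_neutral_cong_right) auto
      also have "\<dots> = measure W {L\<in>F. Pr L}" using finF by (simp add: measure_measure_pmf_finite)
      also have "\<dots> = measure W {L. filter (\<lambda>x. x \<in> B) L = \<sigma> \<and> Pr L}"
        by (intro measure_pmf.finite_measure_eq_AE) (auto simp: AE_measure_pmf_iff F_def)
      finally show ?thesis .
    qed
    have probR: "(\<Sum>L\<in>F. pmf W L * of_bool (R i L)) = q * (pmf D (xs ! i) / sum (pmf D) (insert (xs ! i)
        (B \<union> set (take i xs))))"
      if i: "i < length xs" for i
    proof -
      have iX: "xs ! i \<in> X" using i xs(1) nth_mem by blast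
      have "xs ! i \<notin> set (take i xs)" using xs(2) i by (auto simp: in_set_conv_nth nth_eq_iff_index_eq)
      then have "xs ! i \<notin> B \<union> set (take i xs)" using iX X(2) by blast
      moreover have "insert (xs ! i) (B \<union> set (take i xs)) \<subseteq> set_pmf D"
        using set_take_subset[of i xs] iX xs(1) X(3) A(1) by blast
      ultimately have "measure W {L. filter (\<lambda>x. x \<in> B) L = \<sigma> \<and> R i L} =
          q * (pmf D (xs ! i) / sum (pmf D) (insert (xs ! i) (B \<union> set (take i xs))))"
        unfolding R_def q_def W by (intro prob_filter_and_beats[OF fin order_refl]) auto
      then show ?thesis by (simp only: sum_prob[of "R i"])
    qed
    have probU: "(\<Sum>L\<in>F. pmf W L * of_bool (U x L)) = q * (pmf D x / sum (pmf D) A)" if x: "x \<in> X" for x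
    proof -
      have ins: "insert x (A - {x}) = A" using x X(3) by blast
      have "B \<subseteq> A - {x}" using x X(2) BA(1) by blast
      then have "measure W {L. filter (\<lambda>x. x \<in> B) L = \<sigma> \<and> U x L} = q * (pmf D x / sum (pmf D) A)"
        unfolding U_def q_def W
        using prob_filter_and_beats[OF fin order_refl, of B "A - {x}" x \<sigma>] A(1) unfolding ins by simp
      then show ?thesis by (simp only: sum_prob[of "U x"])
    qed
    have q: "(\<Sum>L\<in>F. pmf W L) = q"
    proof -
      have "(\<Sum>L\<in>F. pmf W L) = measure W (filter (\<lambda>x. x \<in> B) -` {\<sigma>})"
        using sum_prob[of "\<lambda>_. True"] by (simp add: vimage_def)
      also have "\<dots> = pmf (map_pmf (filter (\<lambda>x. x \<in> B)) W) \<sigma>" by (simp add: pmf_map)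
      also have "map_pmf (filter (\<lambda>x. x \<in> B)) W = weighted_draws (card B) D B"
        unfolding W using BA A by (intro filter_weighted_draws[OF fin]) auto
      finally show ?thesis unfolding q_def .
    qed
    have pos: "pmf D x > 0" if "x \<in> A" for x using that A(1) by (auto intro: pmf_positive)
    have Bpos: "sum (pmf D) B > 0" using BA pos by (intro sum_pos) (auto simp: B_def)
    have "(\<Sum>i<length xs. pmf D (xs ! i) / sum (pmf D) (insert (xs ! i) (B \<union> set (take i xs))))
        \<le> ln (sum (pmf D) (B \<union> set xs) / sum (pmf D) B)"
      using X xs pos by (intro sum_record_probabilities_le_ln[OF Bpos BA(2) xs(2)]) auto
    also have "\<dots> = ln (sum (pmf D) A / sum (pmf D) B)" unfolding xs(1) X(3)[symmetric] ..
    finally have bound1: "(\<Sum>i<length xs. pmf D (xs ! i) / sum (pmf D) (insert (xs ! i)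
        (B \<union> set (take i xs)))) \<le> ln (sum (pmf D) A / sum (pmf D) B)" .
    have "ln (sum (pmf D) (B \<union> X) / sum (pmf D) B) - (\<Sum>x\<in>X. pmf D x / sum (pmf D) (B \<union> X) *
        (ln (pmf D x) - ln (pmf D t))) \<le> ln (real (Suc (card X)))"
    proof (rule collapsed_entropy_le[OF BA(2) Bpos X(1,2)])
      show "pmf D t \<le> sum (pmf D) B" using BA(2) by (intro member_le_sum) (auto simp: B_def)
    qed (use pos tA X(3) in auto)
    then have bound2: "ln (sum (pmf D) A / sum (pmf D) B)
        - (\<Sum>x\<in>X. pmf D x / sum (pmf D) A * (ln (pmf D x) - ln (pmf D t))) \<le> ln (real (Suc (card X)))"
      unfolding X(3)[symmetric] .
    \<comment> \<open>Here \<open>t\<close> stands for the atom into which \<open>B\<close> was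
      collapsed.\<close>
    have "A - C t = insert t X" "t \<notin> X" using tA BA(3) unfolding X_def B_def by auto
    then have "card (A - C t) = Suc (card X)" using X(1) by simp
    then have bound3: "ln (real (Suc (card X))) \<le> ln k" using k[OF tA] by simp
    have swap1: "(\<Sum>L\<in>F. pmf W L * (\<Sum>i<length xs. of_bool (R i L)))
        = (\<Sum>i<length xs. \<Sum>L\<in>F. pmf W L * of_bool (R i L))"
      unfolding sum_distrib_left by (rule sum.swap)
    have swap2: "(\<Sum>L\<in>F. pmf W L * (\<Sum>x\<in>X. of_bool (U x L) * h x))
        = (\<Sum>x\<in>X. (\<Sum>L\<in>F. pmf W L * of_bool (U x L)) * h x)"
      for h :: "'a \<Rightarrow> real"
      unfolding sum_distrib_left sum_distrib_right mult.assoc by (rule sum.swap)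
    have "(\<Sum>L\<in>F. pmf W L * surplus D L (S L)) \<le>
        (\<Sum>L\<in>F. pmf W L * ((\<Sum>i<length xs. of_bool (R i L))
            - (\<Sum>x\<in>X. of_bool (U x L) * (ln (pmf D x) - ln (pmf D t)))))"
      using Z by (intro sum_mono mult_left_mono) auto
    also have "\<dots> = (\<Sum>i<length xs. \<Sum>L\<in>F. pmf W L * of_bool (R i L))
        - (\<Sum>x\<in>X. (\<Sum>L\<in>F. pmf W L * of_bool (U x L)) * (ln (pmf D x) - ln (pmf D t)))"
      unfolding swap1[symmetric] swap2[symmetric] sum_subtractf[symmetric]
      by (intro sum.cong refl right_diff_distrib)
    also have "\<dots> = q * ((\<Sum>i<length xs. pmf D (xs ! i) / sum (pmf D) (insert (xs ! i) (B \<union> set (take i xs))))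
         - (\<Sum>x\<in>X. pmf D x / sum (pmf D) A * (ln (pmf D x) - ln (pmf D t))))"
    proof -
      have "(\<Sum>x\<in>X. (\<Sum>L\<in>F. pmf W L * of_bool (U x L)) * h x) = q * (\<Sum>x\<in>X. pmf D x / sum (pmf D) A * h x)"
        for h :: "'a \<Rightarrow> real"
        unfolding sum_distrib_left by (intro sum.cong refl) (simp only: probU mult.assoc)
      moreover have "(\<Sum>i<length xs. \<Sum>L\<in>F. pmf W L * of_bool (R i L)) =
          q * (\<Sum>i<length xs. pmf D (xs ! i) / sum (pmf D) (insert (xs ! i) (B \<union> set (take i xs))))"
        unfolding sum_distrib_left by (intro sum.cong refl probR) simp
      ultimately show ?thesis by (simp only: right_diff_distrib[of q])
    qed
    also have "\<dots> \<le> q * ln k"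
      using bound1 bound2 bound3 by (intro mult_left_mono) (auto simp: q_def)
    also have "\<dots> = (\<Sum>L\<in>F. pmf W L * ln k)" by (simp add: q[symmetric] sum_distrib_right)
    finally show ?thesis unfolding gF .
  qed
  have "measure_pmf.expectation W (\<lambda>L. surplus D L (S L)) = (\<Sum>L\<in>set_pmf W. pmf W L * surplus D L (S L))"
    using finW by (subst integral_measure_pmf_real[of "set_pmf W"]) (auto simp: mult.commute)
  also have "\<dots> = (\<Sum>\<gamma>\<in>g ` set_pmf W. \<Sum>L | L \<in> set_pmf W \<and> g L = \<gamma>. pmf W L * surplus D L (S L))"
    by (rule sum.image_gen[OF finW])
  also have "\<dots> \<le> (\<Sum>\<gamma>\<in>g ` set_pmf W. \<Sum>L | L \<in> set_pmf W \<and> g L = \<gamma>. pmf W L * ln k)"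
    by (rule sum_mono) (elim imageE, simp only: fibre)
  also have "\<dots> = (\<Sum>L\<in>set_pmf W. pmf W L * ln k)" by (rule sum.image_gen[OF finW, symmetric])
  also have "\<dots> = ln k" using finW by (simp add: sum_distrib_right[symmetric] sum_pmf_eq_1)
  finally show ?thesis unfolding W_def S_def .
qed

section \<open>Both sides of the market\<close>

lemma finite_set_popularity_ranking:
  "finite (set_pmf D) \<Longrightarrow> finite (set_pmf (popularity_ranking D))"
  unfolding popularity_ranking_def by (intro finite_set_weighted_draws) auto

lemma set_popularity_ranking:
  "finite (set_pmf D) \<Longrightarrow> L \<in> set_pmf (popularity_ranking D) \<Longrightarrow> set L = set_pmf D"
  unfolding popularity_ranking_def using set_weighted_draws by blast

lemma set_random_profile:
  assumes fin: "finite Men" "finite Women"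
    and D: "\<And>m. m \<in> Men \<Longrightarrow> finite (set_pmf (DM m))" "\<And>w. w \<in> Women \<Longrightarrow> finite (set_pmf (DW w))"
  shows "finite (set_pmf (random_profile Men Women DM DW))"
    and "(P, Q) \<in> set_pmf (random_profile Men Women DM DW) \<Longrightarrow>
      (\<forall>m\<in>Men. set (P m) = set_pmf (DM m)) \<and> (\<forall>w\<in>Women. set (Q w) = set_pmf (DW w))"
proof -
  show "finite (set_pmf (random_profile Men Women DM DW))"
    unfolding random_profile_def set_pair_pmf
    by (intro finite_cartesian_product)
      (simp_all add: set_Pi_pmf finite_PiE_dflt finite_set_popularity_ranking D fin)
  assume "(P, Q) \<in> set_pmf (random_profile Men Women DM DW)"
  then have "\<And>m. m \<in> Men \<Longrightarrow> P m \<in> set_pmf (popularity_ranking (DM m))"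
    and "\<And>w. w \<in> Women \<Longrightarrow> Q w \<in> set_pmf (popularity_ranking (DW w))"
    unfolding random_profile_def using fin by (auto simp: set_Pi_pmf PiE_dflt_def)
  then show "(\<forall>m\<in>Men. set (P m) = set_pmf (DM m)) \<and> (\<forall>w\<in>Women. set (Q w) = set_pmf (DW w))"
    using D set_popularity_ranking by metis
qed

lemma random_profile_swap:
  "random_profile Women Men DW DM = map_pmf prod.swap (random_profile Men Women DM DW)"
  unfolding random_profile_def by (subst pair_commute_pmf) (auto intro!: map_pmf_cong)

text \<open>Independence in the form of invariance: redrawing the list of \<open>m\<close> does not
  change the law. An estimate for the random list of \<open>m\<close> with all other lists fixed
  therefore carries over to the whole profile.\<close>

lemma random_profile_resample:
  assumes fin: "finite Men" and m: "m \<in> Men"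
  shows "random_profile Men Women DM DW = bind_pmf (random_profile Men Women DM DW)
    (\<lambda>(P, Q). map_pmf (\<lambda>L. (P(m := L), Q)) (popularity_ranking (DM m)))"
proof -
  let ?p = "\<lambda>m. popularity_ranking (DM m)" and ?q = "Pi_pmf Women [] (\<lambda>w. popularity_ranking (DW w))"
  have "Pi_pmf Men [] ?p = map_pmf (\<lambda>(y, f). f(m := y)) (pair_pmf (?p m) (Pi_pmf (Men - {m}) [] ?p))"
    using Pi_pmf_insert[of "Men - {m}" m "[]" ?p] fin m by (simp add: insert_absorb)
  then have "random_profile Men Women DM DW = bind_pmf (?p m) (\<lambda>y. bind_pmf (Pi_pmf (Men - {m}) [] ?p)
      (\<lambda>f. bind_pmf ?q (\<lambda>Q. return_pmf (f(m := y), Q))))"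
    unfolding random_profile_def pair_pmf_def map_pmf_def by (simp add: bind_assoc_pmf bind_return_pmf)
  note rp = this
  have "bind_pmf (random_profile Men Women DM DW) (\<lambda>(P, Q). map_pmf (\<lambda>L. (P(m := L), Q)) (?p m)) =
    bind_pmf (Pi_pmf (Men - {m}) [] ?p) (\<lambda>f. bind_pmf ?q (\<lambda>Q. bind_pmf (?p m) (\<lambda>L. return_pmf
        (f(m := L), Q))))"
    unfolding rp by (simp add: bind_assoc_pmf bind_return_pmf map_pmf_def)
  also have "\<dots> = bind_pmf (Pi_pmf (Men - {m}) [] ?p) (\<lambda>f. bind_pmf (?p m) (\<lambda>L. bind_pmf ?q
      (\<lambda>Q. return_pmf (f(m := L), Q))))"
    by (intro bind_pmf_cong refl bind_commute_pmf)
  also have "\<dots> = random_profile Men Women DM DW"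
    unfolding rp by (rule bind_commute_pmf)
  finally show ?thesis ..
qed

lemma expectation_random_profile_le:
  fixes c :: real
  assumes fin: "finite Men" "finite Women"
    and D: "\<And>m. m \<in> Men \<Longrightarrow> finite (set_pmf (DM m))" "\<And>w. w \<in> Women \<Longrightarrow> finite (set_pmf (DW w))"
    and m: "m \<in> Men"
    and le: "\<And>P Q. measure_pmf.expectation (popularity_ranking (DM m)) (\<lambda>L. f (P(m := L), Q)) \<le> c"
  shows "measure_pmf.expectation (random_profile Men Women DM DW) f \<le> c"
proof -
  let ?R = "random_profile Men Women DM DW"
  note finR = set_random_profile(1)[OF fin D]
  have "measure_pmf.expectation ?R f = measure_pmf.expectation (bind_pmf ?R
     (\<lambda>(P, Q). map_pmf (\<lambda>L. (P(m := L), Q)) (popularity_ranking (DM m)))) f"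
    by (subst random_profile_resample[OF fin(1) m]) simp
  also have "\<dots> = (\<Sum>x\<in>set_pmf ?R. pmf ?R x *\<^sub>R measure_pmf.expectation
     (case x of (P, Q) \<Rightarrow> map_pmf (\<lambda>L. (P(m := L), Q)) (popularity_ranking (DM m))) f)"
    using finR finite_set_popularity_ranking[OF D(1)[OF m]]
    by (intro pmf_expectation_bind) (auto split: prod.splits)
  also have "\<dots> \<le> (\<Sum>x\<in>set_pmf ?R. pmf ?R x *\<^sub>R c)"
    using le by (intro sum_mono scaleR_left_mono) (auto split: prod.splits)
  also have "\<dots> = c" using finR by (simp add: sum_distrib_right[symmetric] sum_pmf_eq_1)
  finally show ?thesis .
qed

text \<open>In the second bound the number of favourites is 1 or 0, so \<open>ln N\<close> is
  charged only to people with a stable partner. This matters on the larger side of the market, where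
  more than \<open>N\<close> people may live but at most \<open>N\<close> are ever matched in one
  matching.\<close>

lemma expectation_partner_surplus_le:
  fixes Men :: "'m set" and Women :: "'w set"
  assumes fin: "finite Men" "finite Women"
    and D: "\<And>m. m \<in> Men \<Longrightarrow> set_pmf (DM m) \<subseteq> Women" "\<And>w. w \<in> Women \<Longrightarrow> set_pmf (DW w) \<subseteq> Men"
    and m: "m \<in> Men"
  shows "measure_pmf.expectation (random_profile Men Women DM DW)
      (\<lambda>(P, Q). surplus (DM m) (P m) (stable_pairs Men Women P Q `` {m})) \<le> ln (real (card (set_pmf (DM m))))"
    and "measure_pmf.expectation (random_profile Men Women DM DW)
      (\<lambda>(P, Q). surplus (DM m) (P m) (stable_pairs Men Women P Q `` {m})
         - real (card (favourites (P m) (stable_pairs Men Women P Q `` {m}))) * ln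
             (real (min (card Men) (card Women)))) \<le> 0"
proof -
  let ?d = "real (card (set_pmf (DM m)))" and ?N = "real (min (card Men) (card Women))"
    and ?R = "popularity_ranking (DM m)" and ?S = "\<lambda>P Q. stable_pairs Men Women P Q `` {m}"
  have finD: "\<And>m. m \<in> Men \<Longrightarrow> finite (set_pmf (DM m))" "\<And>w. w \<in> Women \<Longrightarrow> finite (set_pmf (DW w))"
    using finite_subset[OF D(1) fin(2)] finite_subset[OF D(2) fin(1)] by auto
  have fR: "finite (set_pmf ?R)" by (rule finite_set_popularity_ranking[OF finD(1)[OF m]])
  have "card (set_pmf (DM m)) > 0" using finD(1)[OF m] by (simp add: card_gt_0_iff set_pmf_not_empty)
  \<comment> \<open>Used when nobody can be a stable partner of \<open>m\<close>: the surplus is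
    then 0.\<close>
  then have d0: "ln ?d \<ge> 0" by simp
  have *: "measure_pmf.expectation ?R (\<lambda>L. surplus (DM m) L (?S (P(m := L)) Q)) \<le> ln ?d \<and>
    measure_pmf.expectation ?R (\<lambda>L. surplus (DM m) L (?S (P(m := L)) Q) - real
        (card (favourites L (?S (P(m := L)) Q))) * ln ?N) \<le> 0" for P Q
  proof -
    obtain A C where A: "A \<subseteq> set_pmf (DM m)" and CA: "\<And>t. t \<in> A \<Longrightarrow> C t \<subseteq> A - {t}"
      and chain: "\<And>s t. s \<in> A \<Longrightarrow> t \<in> A \<Longrightarrow> s \<noteq> t \<Longrightarrow> t \<notin> C s \<Longrightarrow> insert s (C s) \<subseteq> C t"
      and bound: "\<And>t. t \<in> A \<Longrightarrow> card (A - C t) \<le> min (card Men) (card Women)"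
      and char: "\<And>L. set L = set_pmf (DM m) \<Longrightarrow>
      {w. (m, w) \<in> stable_pairs Men Women (P(m := L)) Q} = {t \<in> A. \<forall>c\<in>C t. prefers L t c}"
      by (rule stable_partners_structure[OF fin D(1)[OF m] m, of P Q]) (rule that)
    define S where "S L = {t \<in> A. \<forall>c\<in>C t. prefers L t c}" for L
    have S: "?S (P(m := L)) Q = S L" if "L \<in> set_pmf ?R" for L
      using char[OF set_popularity_ranking[OF finD(1)[OF m] that]] unfolding S_def Image_singleton .
    have E: "measure_pmf.expectation ?R (\<lambda>L. h L (?S (P(m := L)) Q)) = measure_pmf.expectation ?R
        (\<lambda>L. h L (S L))"
      for h :: "'w list \<Rightarrow> 'w set \<Rightarrow> real"
      using S by (intro integral_cong_AE) (auto simp: AE_measure_pmf_iff)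
    show ?thesis
    proof (cases "A = {}")
      case True
      then have "S L = {}" for L unfolding S_def by simp
      moreover have "surplus (DM m) L {} = 0" "favourites L {} = {}" for L
        unfolding surplus_def favourites_def least_favourites_def by auto
      ultimately show ?thesis unfolding E[of "surplus (DM m)"]
          E[of "\<lambda>L T. surplus (DM m) L T - real (card (favourites L T)) * ln ?N"]
        using d0 by simp
    next
      case False
      have le_d: "card (A - C t) \<le> card (set_pmf (DM m))" for t
        using A finD(1)[OF m] by (intro card_mono) auto
      have 1: "measure_pmf.expectation ?R (\<lambda>L. surplus (DM m) L (S L)) \<le> ln ?d"
        unfolding S_def using le_d by (intro expectation_surplus_le[OF finD(1)[OF m] A False CA chain]) auto
      have 2: "measure_pmf.expectation ?R (\<lambda>L. surplus (DM m) L (S L)) \<le> ln ?N"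
        unfolding S_def using bound
            by (intro expectation_surplus_le[OF finD(1)[OF m] A False CA chain]) fastforce+
      have "card (favourites L (S L)) = 1" if "L \<in> set_pmf ?R" for L
      proof -
        have L: "A \<subseteq> set L" using set_popularity_ranking[OF finD(1)[OF m] that] A by blast
        obtain x where x: "x \<in> A" "\<And>y. y \<in> A \<Longrightarrow> y \<noteq> x \<Longrightarrow> prefers L x y"
          using favourite_exists[OF False L] by blast
        have xS: "x \<in> S L" using x CA unfolding S_def by blast
        have "S L \<subseteq> A" unfolding S_def by blast
        then have "favourites L (S L) = {x}" using x(2) by (intro favourites_singleton[OF xS]) auto
        then show ?thesis by simp
      qed
      then have "measure_pmf.expectation ?R (\<lambda>L. surplus (DM m) L (S L) - real
          (card (favourites L (S L))) * ln ?N)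
        = measure_pmf.expectation ?R (\<lambda>L. surplus (DM m) L (S L) - ln ?N)"
        by (intro integral_cong_AE) (auto simp: AE_measure_pmf_iff)
      also have "\<dots> = measure_pmf.expectation ?R (\<lambda>L. surplus (DM m) L (S L)) - ln ?N"
        using fR by (subst Bochner_Integration.integral_diff) (auto intro: integrable_measure_pmf_finite)
      finally show ?thesis using 1 2 unfolding E[of "surplus (DM m)"]
          E[of "\<lambda>L T. surplus (DM m) L T - real (card (favourites L T)) * ln ?N"] by simp
    qed
  qed
  show "measure_pmf.expectation (random_profile Men Women DM DW)
      (\<lambda>(P, Q). surplus (DM m) (P m) (?S P Q)) \<le> ln ?d"
    by (rule expectation_random_profile_le[OF fin finD m]) (use * in simp_all)
  show "measure_pmf.expectation (random_profile Men Women DM DW)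
      (\<lambda>(P, Q). surplus (DM m) (P m) (?S P Q) - real (card (favourites (P m) (?S P Q))) * ln ?N) \<le> 0"
    by (rule expectation_random_profile_le[OF fin finD m]) (use * in simp_all)
qed

text \<open>If \<open>w\<close> is best for \<open>m\<close> but had a worse stable partner than
  \<open>m\<close>, the pair would block that other matching. Conversely, in a stable matching where
  \<open>m\<close> does better than \<open>w\<close>, opposition leaves \<open>w\<close> with a
  partner worse than \<open>m\<close>.\<close>

lemma favourite_iff_least_favourite:
  assumes fin: "finite Men" "finite Women" and mw: "(m, w) \<in> stable_pairs Men Women P Q"
  shows "w \<in> favourites (P m) (stable_pairs Men Women P Q `` {m}) \<longleftrightarrow>
    m \<in> least_favourites (Q w) ((stable_pairs Men Women P Q)\<inverse> `` {w})"
proof -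
  obtain \<mu> where mu: "stable_matching Men Women P Q \<mu>" "(m, w) \<in> \<mu>"
    using mw unfolding stable_pairs_def by blast
  note a = stable_matchingD[OF mu(1)]
  have mem: "m \<in> Men" "w \<in> Women" "w \<in> set (P m)" "m \<in> set (Q w)"
    using a(1) mu(2) a(4,5)[OF mu(2)] by auto
  show ?thesis
  proof
    assume fav: "w \<in> favourites (P m) (stable_pairs Men Women P Q `` {m})"
    have "\<not> prefers (Q w) m m'" if m': "(m', w) \<in> stable_pairs Men Women P Q" for m'
    proof
      assume pr: "prefers (Q w) m m'"
      obtain \<mu>' where mu': "stable_matching Men Women P Q \<mu>'" "(m', w) \<in> \<mu>'"
        using m' unfolding stable_pairs_def by blast
      note b = stable_matchingD[OF mu'(1)]
      have "\<mu>'\<inverse> `` {w} = {m'}" using b(3) mu'(2) by blast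
      then have "\<not> prefers_to_current (P m) w (\<mu>' `` {m})"
        using b(6)[OF mem(1,2)] pr mem(4) unfolding blocking_pair_def prefers_to_current_def by simp
      then obtain w' where w': "(m, w') \<in> \<mu>'" "\<not> prefers (P m) w w'"
        using mem(3) unfolding prefers_to_current_def by auto
      have "w' \<noteq> w" using w'(1) b(3)[OF mu'(2)] pr prefers_irrefl by metis
      then have "prefers (P m) w' w" using prefers_total w'(2) mem(3) by metis
      then show False using fav w'(1) mu'(1) unfolding favourites_def stable_pairs_def by blast
    qed
    then show "m \<in> least_favourites (Q w) ((stable_pairs Men Women P Q)\<inverse> `` {w})"
      using mw unfolding least_favourites_def by blast
  next
    assume least: "m \<in> least_favourites (Q w) ((stable_pairs Men Women P Q)\<inverse> `` {w})"
    have "\<not> prefers (P m) w' w" if w': "(m, w') \<in> stable_pairs Men Women P Q" for w'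
    proof
      assume pr: "prefers (P m) w' w"
      obtain \<mu>' where mu': "stable_matching Men Women P Q \<mu>'" "(m, w') \<in> \<mu>'"
        using w' unfolding stable_pairs_def by blast
      have im: "\<mu> `` {m} = {w}" using a(2) mu(2) by blast
      have "prefers_to_current (P m) w' (\<mu> `` {m})"
        using pr prefers_mem unfolding im prefers_to_current_def by fast
      from stable_opposition[OF fin mu'(1) mu(1) mu'(2) this]
      have pq: "prefers_to_current (Q w) m (\<mu>'\<inverse> `` {w})" using a(2)[OF mu(2)] by blast
      have "(w, m) \<in> \<mu>\<inverse>" using mu(2) by simp
      \<comment> \<open>Opposition with the sexes exchanged serves only to show that
        \<open>w\<close> is not single in \<open>\<mu>'\<close>.\<close>
      then obtain m' where m': "(m', w) \<in> \<mu>'"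
        using stable_opposition[OF fin(2,1) stable_matching_swap[THEN iffD2, OF mu(1)] stable_matching_swap[THEN iffD2, OF mu'(1)], of w m] pq
        by auto
      then have "prefers (Q w) m m'" using pq unfolding prefers_to_current_def by blast
      then show False using least m' mu'(1) unfolding least_favourites_def stable_pairs_def by blast
    qed
    then show "w \<in> favourites (P m) (stable_pairs Men Women P Q `` {m})"
      using mw unfolding favourites_def by blast
  qed
qed

section \<open>Summation over the edges of the extremal matchings\<close>

lemma sum_Image:
  assumes "finite A" "finite B" "T \<subseteq> A \<times> B"
  shows "(\<Sum>x\<in>A. \<Sum>y\<in>T `` {x}. h x y) = (\<Sum>(x, y)\<in>T. h x y)"
proof -
  have "finite (T `` {x})" for x
    by (rule finite_subset[OF _ assms(2)]) (use assms(3) in blast)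
  then have "(\<Sum>x\<in>A. \<Sum>y\<in>T `` {x}. h x y) = (\<Sum>(x, y)\<in>Sigma A (\<lambda>x. T `` {x}). h x y)"
    using assms(1) by (intro sum.Sigma) auto
  also have "Sigma A (\<lambda>x. T `` {x}) = T" using assms(3) by auto
  finally show ?thesis .
qed

lemma sum_converse_Image:
  assumes "finite A" "finite B" "T \<subseteq> A \<times> B"
  shows "(\<Sum>y\<in>B. \<Sum>x\<in>T\<inverse> `` {y}. h x y) = (\<Sum>(x, y)\<in>T. h x y)"
proof -
  have "(\<Sum>y\<in>B. \<Sum>x\<in>T\<inverse> `` {y}. h x y) = (\<Sum>(y, x)\<in>T\<inverse>. h x y)"
    using assms by (intro sum_Image) auto
  also have "\<dots> = (\<Sum>(x, y)\<in>T. h x y)"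
    by (rule sum.reindex_bij_witness[of _ prod.swap prod.swap]) auto
  finally show ?thesis .
qed

text \<open>\<open>T\<^sub>M\<close> is the men-optimal and \<open>T\<^sub>W\<close> the women-optimal stable matching. The best partner on one
  side is the worst on the other, so up to the factor \<open>r\<close> the logarithmic terms cancel.\<close>

lemma sum_surplus_ge:
  fixes Men :: "'m set" and Women :: "'w set" and r :: real
  assumes fin: "finite Men" "finite Women"
    and supp: "\<And>m. m \<in> Men \<Longrightarrow> set (P m) = set_pmf (DM m)" "\<And>w. w \<in> Women \<Longrightarrow> set (Q w) = set_pmf (DW w)"
    and r: "r \<ge> 1" "\<And>m w. m \<in> Men \<Longrightarrow> w \<in> Women \<Longrightarrow> w \<in> set_pmf (DM m) \<Longrightarrow> m \<in> set_pmf (DW w) \<Longrightarrow>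
           pmf (DW w) m \<le> r * pmf (DM m) w \<and> pmf (DM m) w \<le> r * pmf (DW w) m"
  defines "SP \<equiv> stable_pairs Men Women P Q"
  defines "FM \<equiv> (\<Sum>m\<in>Men. real (card (favourites (P m) (SP `` {m}))))"
    and "FW \<equiv> (\<Sum>w\<in>Women. real (card (favourites (Q w) (SP\<inverse> `` {w}))))"
  shows "2 * real (card SP) - (1 + ln r) * (FM + FW) \<le>
      (\<Sum>m\<in>Men. surplus (DM m) (P m) (SP `` {m})) + (\<Sum>w\<in>Women. surplus (DW w) (Q w) (SP\<inverse> `` {w}))"
    and "FM \<le> real (min (card Men) (card Women))" and "FW \<le> real (min (card Men) (card Women))"
proof -
  define T\<^sub>M where "T\<^sub>M = {(m, w) \<in> SP. w \<in> favourites (P m) (SP `` {m})}"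
  define T\<^sub>W where "T\<^sub>W = {(m, w) \<in> SP. m \<in> favourites (Q w) (SP\<inverse> `` {w})}"
  have SP: "m \<in> Men \<and> w \<in> Women \<and> w \<in> set (P m) \<and> m \<in> set (Q w)" if "(m, w) \<in> SP" for m w
    using that stable_matchingD(1,4,5) unfolding SP_def stable_pairs_def by fast
  then have sub: "SP \<subseteq> Men \<times> Women" by auto
  then have sT: "T\<^sub>M \<subseteq> Men \<times> Women" "T\<^sub>W \<subseteq> Men \<times> Women" unfolding T\<^sub>M_def T\<^sub>W_def by auto
  have opp1: "w \<in> favourites (P m) (SP `` {m}) \<longleftrightarrow> m \<in> least_favourites (Q w) (SP\<inverse> `` {w})"
      if "(m, w) \<in> SP" for m w
    using favourite_iff_least_favourite[OF fin] that unfolding SP_def by blast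
  have opp2: "m \<in> favourites (Q w) (SP\<inverse> `` {w}) \<longleftrightarrow> w \<in> least_favourites (P m) (SP `` {m})"
      if "(m, w) \<in> SP" for m w
    using favourite_iff_least_favourite[OF fin(2,1), of w m Q P] that
    unfolding SP_def stable_pairs_swap[of Women Men] by simp
  have M1: "favourites (P m) (SP `` {m}) = T\<^sub>M `` {m}" for m
    unfolding T\<^sub>M_def favourites_def by auto
  have W2: "favourites (Q w) (SP\<inverse> `` {w}) = T\<^sub>W\<inverse> `` {w}" for w
    unfolding T\<^sub>W_def favourites_def by auto
  have M2: "least_favourites (Q w) (SP\<inverse> `` {w}) = T\<^sub>M\<inverse> `` {w}" for w
  proof -
    have "m \<in> least_favourites (Q w) (SP\<inverse> `` {w}) \<Longrightarrow> (m, w) \<in> SP" for m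
      unfolding least_favourites_def by blast
    then show ?thesis using opp1 unfolding T\<^sub>M_def by auto
  qed
  have W1: "least_favourites (P m) (SP `` {m}) = T\<^sub>W `` {m}" for m
  proof -
    have "w \<in> least_favourites (P m) (SP `` {m}) \<Longrightarrow> (m, w) \<in> SP" for w
      unfolding least_favourites_def by blast
    then show ?thesis using opp2 unfolding T\<^sub>W_def by auto
  qed
  have uM: "w = w'" if "w \<in> favourites (P m) (SP `` {m})" "w' \<in> favourites (P m) (SP `` {m})" for m w w'
    using that SP prefers_total[of "P m" w w'] unfolding favourites_def by fast
  have lM: "w = w'" if "w \<in> least_favourites (P m) (SP `` {m})"
      "w' \<in> least_favourites (P m) (SP `` {m})" for m w w'
    using that SP prefers_total[of "P m" w w'] unfolding least_favourites_def by fast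
  have uW: "m = m'" if "m \<in> favourites (Q w) (SP\<inverse> `` {w})" "m' \<in> favourites (Q w) (SP\<inverse> `` {w})" for m m' w
    using that SP prefers_total[of "Q w" m m'] unfolding favourites_def by fast
  have lW: "m = m'" if "m \<in> least_favourites (Q w) (SP\<inverse> `` {w})"
      "m' \<in> least_favourites (Q w) (SP\<inverse> `` {w})" for m m' w
    using that SP prefers_total[of "Q w" m m'] unfolding least_favourites_def by fast
  have FM: "FM = real (card T\<^sub>M)" and FW: "FW = real (card T\<^sub>W)"
    unfolding FM_def FW_def M1 W2
    using sum_Image[OF fin sT(1), of "\<lambda>_ _. 1::real"] sum_converse_Image[OF fin sT(2), of "\<lambda>_ _. 1::real"]
    by (simp_all add: case_prod_unfold)
  have card_le: "card T \<le> min (card Men) (card Women)" if "T \<subseteq> Men \<times> Women"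
    "\<And>m w w'. w \<in> T `` {m} \<Longrightarrow> w' \<in> T `` {m} \<Longrightarrow> w = w'" "\<And>m m' w. m \<in> T\<inverse> `` {w} \<Longrightarrow> m' \<in> T\<inverse> `` {w} \<Longrightarrow> m = m'" for T
  proof -
    have "inj_on fst T" "inj_on snd T" using that(2,3) by (auto simp: inj_on_def)
    moreover have "fst ` T \<subseteq> Men" "snd ` T \<subseteq> Women" using that(1) by auto
    ultimately show ?thesis using fin by (simp add: card_inj_on_le)
  qed
  show "FM \<le> real (min (card Men) (card Women))"
    unfolding FM of_nat_le_iff
    by (rule card_le[OF sT(1)]) (use uM lW in \<open>simp_all only: M1 M2\<close>)
  show "FW \<le> real (min (card Men) (card Women))"
    unfolding FW of_nat_le_iff
    by (rule card_le[OF sT(2)]) (use uW lM in \<open>simp_all only: W1 W2\<close>)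
  let ?M = "\<lambda>m w. ln (pmf (DM m) w)" and ?W = "\<lambda>m w. ln (pmf (DW w) m)"
  have ratio: "\<bar>?M m w - ?W m w\<bar> \<le> ln r" if "(m, w) \<in> SP" for m w
  proof -
    have mw: "m \<in> Men" "w \<in> Women" "w \<in> set_pmf (DM m)" "m \<in> set_pmf (DW w)"
      using SP[OF that] supp by auto
    have pos: "pmf (DM m) w > 0" "pmf (DW w) m > 0" using mw by (auto intro: pmf_positive)
    have "ln (pmf (DW w) m) \<le> ln (r * pmf (DM m) w)" "ln (pmf (DM m) w) \<le> ln (r * pmf (DW w) m)"
      using r(2)[OF mw] pos r(1) by auto
    then show ?thesis using pos r(1) by (simp add: ln_mult)
  qed
  \<comment> \<open>An edge of \<open>T\<^sub>M\<close> contributes \<open>- ?M m w\<close> as the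
    man's best and \<open>?W m w\<close> as the woman's worst, so it loses at most
    \<open>ln r\<close>. For \<open>T\<^sub>W\<close> the roles are exchanged.\<close>
  have tM: "(\<Sum>(m, w)\<in>T\<^sub>M. ?W m w - ?M m w) \<ge> (\<Sum>(m, w)\<in>T\<^sub>M. - ln r)"
    using ratio unfolding T\<^sub>M_def by (intro sum_mono) (fastforce simp: abs_le_iff)
  have tW: "(\<Sum>(m, w)\<in>T\<^sub>W. ?M m w - ?W m w) \<ge> (\<Sum>(m, w)\<in>T\<^sub>W. - ln r)"
    using ratio unfolding T\<^sub>W_def by (intro sum_mono) (fastforce simp: abs_le_iff)
  have cSP: "(\<Sum>m\<in>Men. real (card (SP `` {m}))) = real (card SP)" "(\<Sum>w\<in>Women. real (card (SP\<inverse> `` {w})))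
      = real (card SP)"
    using sum_Image[OF fin sub, of "\<lambda>_ _. 1::real"] sum_converse_Image[OF fin sub, of "\<lambda>_ _. 1::real"]
    by (simp_all add: case_prod_unfold)
  have "(\<Sum>m\<in>Men. surplus (DM m) (P m) (SP `` {m})) = real (card SP) - FM - (\<Sum>(m, w)\<in>T\<^sub>M. ?M m w) +
      (\<Sum>(m, w)\<in>T\<^sub>W. ?M m w)"
    unfolding surplus_def sum.distrib sum_subtractf cSP FM_def[symmetric] M1 W1
      sum_Image[OF fin sT(1), of ?M] sum_Image[OF fin sT(2), of ?M]
    using FM_def unfolding M1 by simp
  moreover have "(\<Sum>w\<in>Women. surplus (DW w) (Q w) (SP\<inverse> `` {w})) = real (card SP) - FW
      - (\<Sum>(m, w)\<in>T\<^sub>W. ?W m w) + (\<Sum>(m, w)\<in>T\<^sub>M. ?W m w)"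
    unfolding surplus_def sum.distrib sum_subtractf cSP M2 W2
      sum_converse_Image[OF fin sT(1), of ?W] sum_converse_Image[OF fin sT(2), of ?W]
    using FW_def unfolding W2 by simp
  moreover have "(\<Sum>(m, w)\<in>T\<^sub>M. ?W m w - ?M m w) = (\<Sum>(m, w)\<in>T\<^sub>M. ?W m w) - (\<Sum>(m, w)\<in>T\<^sub>M. ?M m w)"
    "(\<Sum>(m, w)\<in>T\<^sub>W. ?M m w - ?W m w) = (\<Sum>(m, w)\<in>T\<^sub>W. ?M m w) - (\<Sum>(m, w)\<in>T\<^sub>W. ?W m w)"
    by (simp_all add: case_prod_unfold sum_subtractf)
  moreover have "(\<Sum>(m, w)\<in>T\<^sub>M. - ln r) = - (FM * ln r)" "(\<Sum>(m, w)\<in>T\<^sub>W. - ln r) = - (FW * ln r)"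
    unfolding FM FW by (simp_all add: case_prod_unfold)
  moreover have "(1 + ln r) * (FM + FW) = FM + FW + FM * ln r + FW * ln r" by (simp add: algebra_simps)
  ultimately show "2 * real (card SP) - (1 + ln r) * (FM + FW) \<le>
      (\<Sum>m\<in>Men. surplus (DM m) (P m) (SP `` {m})) + (\<Sum>w\<in>Women. surplus (DW w) (Q w) (SP\<inverse> `` {w}))"
    using tM tW by linarith
qed

text \<open>The summed surpluses contain every stable pair twice. On the support of the profile
  \<open>F\<close> counts the people with a stable partner, at most \<open>N\<close> on each side;
  halving the estimate for both sides gives the coefficient \<open>N\<close> of
  \<open>1 + ln r\<close>.\<close>

theorem theorem9:
  fixes Men :: "'m set" and Women :: "'w set"
    and DM :: "'m \<Rightarrow> 'w pmf" and DW :: "'w \<Rightarrow> 'm pmf"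
    and r :: real and N :: nat
  assumes "finite Men" and "finite Women"
    and "N = min (card Men) (card Women)"
    and "r \<ge> 1"
    and "\<And>m. m \<in> Men \<Longrightarrow> set_pmf (DM m) \<subseteq> Women"
    and "\<And>w. w \<in> Women \<Longrightarrow> set_pmf (DW w) \<subseteq> Men"
    and "\<And>m w. m \<in> Men \<Longrightarrow> w \<in> Women \<Longrightarrow>
           w \<in> set_pmf (DM m) \<Longrightarrow> m \<in> set_pmf (DW w) \<Longrightarrow>
           pmf (DW w) m \<le> r * pmf (DM m) w \<and> pmf (DM m) w \<le> r * pmf (DW w) m"
  shows "expected_stable_pairs Men Women DM DW
           \<le> real N * (1 + ln r)
             + (\<Sum>w\<in>Women. ln (real (card (set_pmf (DW w)))) / 2)
             + (\<Sum>m\<in>Men. ln (real (card (set_pmf (DM m)))) / 2)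
         \<and> (r = 1 \<longrightarrow> expected_stable_pairs Men Women DM DW
               \<le> real N + real N * ln (real N))"
proof -
  let ?R = "random_profile Men Women DM DW" and ?SP = "stable_pairs Men Women"
  let ?E = "measure_pmf.expectation ?R"
  note fin = assms(1,2) and D = assms(5,6)
  have finD: "\<And>m. m \<in> Men \<Longrightarrow> finite (set_pmf (DM m))" "\<And>w. w \<in> Women \<Longrightarrow> finite (set_pmf (DW w))"
    using finite_subset[OF D(1) fin(2)] finite_subset[OF D(2) fin(1)] by auto
  note R = set_random_profile[OF fin, of DM DW, OF finD]
  have int: "integrable ?R f" for f :: "_ \<Rightarrow> real" using R(1) by (rule integrable_measure_pmf_finite)
  define zM where "zM m = (\<lambda>(P, Q). surplus (DM m) (P m) (?SP P Q `` {m}))" for m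
  define zW where "zW w = (\<lambda>(P, Q). surplus (DW w) (Q w) ((?SP P Q)\<inverse> `` {w}))" for w
  define fM where "fM m = (\<lambda>(P, Q). real (card (favourites (P m) (?SP P Q `` {m}))))" for m
  define fW where "fW w = (\<lambda>(P, Q). real (card (favourites (Q w) ((?SP P Q)\<inverse> `` {w}))))" for w
  define c where "c = (\<lambda>(P, Q). real (card (?SP P Q)))"
  define F where "F x = (\<Sum>m\<in>Men. fM m x) + (\<Sum>w\<in>Women. fW w x)" for x
  have e: "expected_stable_pairs Men Women DM DW = ?E c" unfolding expected_stable_pairs_def c_def ..
  have man: "?E (zM m) \<le> ln (real (card (set_pmf (DM m))))" "?E (\<lambda>x. zM m x - fM m x * ln (real N)) \<le> 0"
      if "m \<in> Men" for m
    using expectation_partner_surplus_le[OF fin D that]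
    unfolding zM_def fM_def assms(3) by (simp_all add: case_prod_unfold)
  have woman: "?E (zW w) \<le> ln (real (card (set_pmf (DW w))))" "?E (\<lambda>x. zW w x - fW w x * ln (real N))
      \<le> 0" if "w \<in> Women" for w
    using expectation_partner_surplus_le[OF fin(2,1) D(2,1) that]
    unfolding zW_def fW_def assms(3) random_profile_swap[of Women Men] stable_pairs_swap[of Women Men]
    by (simp_all add: case_prod_unfold min.commute)
  have pw: "2 * c x - (1 + ln r) * F x \<le> (\<Sum>m\<in>Men. zM m x) + (\<Sum>w\<in>Women. zW w x) \<and> F x \<le> 2 * real N"
    if x: "x \<in> set_pmf ?R" for x
  proof -
    obtain P Q where PQ: "x = (P, Q)" by (cases x)
    have "\<And>m. m \<in> Men \<Longrightarrow> set (P m) = set_pmf (DM m)" "\<And>w. w \<in> Women \<Longrightarrow> set (Q w) = set_pmf (DW w)"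
      using R(2)[where P = P and Q = Q] x PQ by auto
    from sum_surplus_ge[OF fin this assms(4,7)] show ?thesis
      unfolding c_def F_def zM_def zW_def fM_def fW_def PQ assms(3) by simp
  qed
  have mono: "?E f \<le> ?E g" if "\<And>x. x \<in> set_pmf ?R \<Longrightarrow> f x \<le> g x" for f g :: "_ \<Rightarrow> real"
    using that by (intro integral_mono_AE int) (auto simp: AE_measure_pmf_iff)
  have main: "2 * ?E c - (1 + ln r) * ?E F \<le> (\<Sum>m\<in>Men. ?E (zM m)) + (\<Sum>w\<in>Women. ?E (zW w))"
  proof -
    have "?E (\<lambda>x. 2 * c x - (1 + ln r) * F x) \<le> ?E (\<lambda>x. (\<Sum>m\<in>Men. zM m x) + (\<Sum>w\<in>Women. zW w x))"
      using pw by (intro mono) blast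
    then show ?thesis by (simp add: int)
  qed
  have F: "?E F \<le> 2 * real N"
    using mono[of F "\<lambda>_. 2 * real N"] pw by simp
  have lnr: "0 \<le> ln r" using assms(4) by simp
  have "(1 + ln r) * ?E F \<le> (1 + ln r) * (2 * real N)" using F lnr by (intro mult_left_mono) auto
  moreover have "(\<Sum>m\<in>Men. ?E (zM m)) \<le> (\<Sum>m\<in>Men. ln (real (card (set_pmf (DM m)))))"
    "(\<Sum>w\<in>Women. ?E (zW w)) \<le> (\<Sum>w\<in>Women. ln (real (card (set_pmf (DW w)))))"
    using man woman by (auto intro: sum_mono)
  ultimately have part1: "?E c \<le> real N * (1 + ln r)
             + (\<Sum>w\<in>Women. ln (real (card (set_pmf (DW w)))) / 2)
             + (\<Sum>m\<in>Men. ln (real (card (set_pmf (DM m)))) / 2)"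
    using main unfolding sum_divide_distrib[symmetric] by (simp add: algebra_simps)
  \<comment> \<open>Each unit of \<open>F\<close> now carries \<open>1 + ln N\<close> in total, so
    the single bound \<open>2 * N\<close> on its expectation controls both terms.\<close>
  have "?E c \<le> real N + real N * ln (real N)" if r1: "r = 1"
  proof -
    have "(\<Sum>m\<in>Men. ?E (zM m)) + (\<Sum>w\<in>Women. ?E (zW w)) \<le> (\<Sum>m\<in>Men. ?E (fM m) * ln (real N)) +
        (\<Sum>w\<in>Women. ?E (fW w) * ln (real N))"
      using man(2) woman(2) by (intro add_mono sum_mono) (simp_all add: int)
    also have "\<dots> = ?E F * ln (real N)"
      unfolding F_def by (simp add: int sum_distrib_right distrib_right)
    finally have "2 * ?E c \<le> ?E F * (1 + ln (real N))" using main r1 by (simp add: algebra_simps)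
    \<comment> \<open>The factor \<open>1 + ln N\<close> is nonnegative also for
      \<open>N = 0\<close>, where \<open>ln 0\<close> has the value 0.\<close>
    also have "\<dots> \<le> 2 * real N * (1 + ln (real N))"
      using F by (intro mult_right_mono) (cases "N = 0"; simp)+
    finally show ?thesis by (simp add: algebra_simps)
  qed
  then show ?thesis using part1 unfolding e by blast
qed

end
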